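(* Assume that there exists $\alpha^*\in[0,1)$ such that for all $\alpha\in(\alpha^*,1]$: (i) the function $x\mapsto\mathbb{E}[h_\alpha(x-D)]$ is quasiconvex on $\mathbb{X}$; and (ii) $\lim_{x\to-\infty}\mathbb{E}[h_\alpha(x-D)]>K+\inf_{x\in\mathbb{X}}\mathbb{E}[h_\alpha(x-D)]$. For each discount factor $\alpha\in(\alpha^*,1)$ consider an optimal $(s'_\alpha,S'_\alpha)$ policy for the discounted criterion with discount factor $\alpha$. Let $\{\alpha_n\}_{n\ge1}$ be a sequence of nonnegative numbers with $\alpha_n\uparrow1$ and $\alpha_1>\alpha^*$. Then every sequence $\{(s'_{\alpha_n},S'_{\alpha_n})\}_{n\ge1}$ is bounded, and each of its limit points $(s^*,S^* )$ defines an average-cost optimal $(s^*,S^* )$ policy. Furthermore, this policy satisfies the optimality inequality $$w+\tilde u(x)\ \ge\ \min\Big\{\min_{a\ge0}[K+H(x+a)],\,H(x)\Big\}-\bar c x,\qquad x\in\mathbb{X},$$ that is, if $\varphi$ denotes the $(s^*,S^* )$ policy, then $w+\tilde u(x)\ge K\mathbf{1}_{\{\varphi(x)>0\}}+H(x+\varphi(x))-\bar cx$ for all $x\in\mathbb{X}$ (so that in particular the displayed inequality holds), where $$H(x):=\bar c x+\mathbb{E}[h(x-D)]+\mathbb{E}[\tilde u(x-D)]$$ and $\tilde u(x):=\liminf_{k\to+\infty,\,y\to x}u_{\alpha_{n_k}}(y)$ for an arbitrary subsequence $\{\alpha_{n_k}\}_{k\ge1}$ of $\{\alpha_n\}_{n\ge1}$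 satisfying $(s^*,S^* )=\lim_{k\to+\infty}(s'_{\alpha_{n_k}},S'_{\alpha_{n_k}})$.
   Context: Inventory model. Either (a) $\mathbb{X}=\mathbb{R}$ (states) and $\mathbb{A}=[0,+\infty)$ (actions), or (b) $\mathbb{X}=\mathbb{Z}$, $\mathbb{A}=\{0,1,2,\ldots\}$ and the demand is integer valued. Constants $K>0$ (fixed ordering cost), $\bar c>0$ (unit ordering cost). $D_1,D_2,\ldots$ are i.i.d. nonnegative finite random variables, $D$ has the same distribution as $D_1$, $\mathbb{E}[D]<+\infty$, $P(D>0)>0$. The holding/backlog cost function $h$ is such that $x\mapsto\mathbb{E}[h(x-D)]$ is finite, continuous and nonnegative on $\mathbb{X}$ and $\mathbb{E}[h(x-D)]\to+\infty$ as $|x|\to+\infty$. Dynamics: $x_{t+1}=x_t+a_t-D_{t+1}$, $t=0,1,\ldots$. One-step cost: $c(x,a)=K\mathbf{1}_{\{a>0\}}+\bar c a+\mathbb{E}[h(x+a-D)]$. Policies may be randomized and history-dependent; $\mathbb{E}_x^\pi$ is the expectation for initial state $x$ and policy $\pi$. $v_\alpha^\pi(x)=\mathbb{E}_x^\pi[\sum_{t=0}^\infty\alpha^t c(x_t,a_t)]$ and $v_\alpha(x)=\inf_\pi v^\pi_\alpha(x)$ for $\alpha\in[0,1)$; $\pi$ is optimal for discount factor $\alpha$ if $v_\alpha^\pi=v_\alpha$ on $\mathbb{X}$. $m_\alpha:=\inf_{x\in\mathbb{X}}v_\alpha(x)$, $u_\alpha(x):=v_\alpha(x)-m_\alpha$,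 and $w:=\lim_{\alpha\uparrow1}(1-\alpha)m_\alpha$ (this limit exists under the hypotheses). Average cost: $w^\pi(x)=\limsup_{N\to+\infty}\frac1N\mathbb{E}_x^\pi[\sum_{t=0}^{N-1}c(x_t,a_t)]$; $\pi$ is average-cost optimal if $w^\pi(x)=\inf_{\pi'}w^{\pi'}(x)$ for all $x\in\mathbb{X}$. For $\alpha\in(0,1]$: $h_\alpha(x):=h(x)+(1-\alpha)\bar c x+\bar c\,\mathbb{E}[D]$. The notation $\liminf_{k\to\infty,y\to x}u_{\alpha_{n_k}}(y)$ means the largest number that is $\le\liminf_{k}u_{\alpha_{n_k}}(y_k)$ for all sequences $y_k\to x$. A function $f$ is quasiconvex if $f(\lambda x+(1-\lambda)y)\le\max\{f(x),f(y)\}$ for all $x,y$ and $\lambda\in[0,1]$ (if $\mathbb{X}=\mathbb{Z}$, whenever $x,y,\lambda x+(1-\lambda)y\in\mathbb{Z}$). For reals $s\le S$, an $(s,S)$ policy is the stationary policy that orders up to level $S$ (action $S-x$) if the current state $x<s$ and does not order (action $0$) if $x\ge s$. Under the hypotheses an optimal $(s,S)$ policy exists for every $\alpha\in(\alpha^*,1)$.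
   Formalization: When the state space is the integers, the levels s and S of the optimal (s,S) policies are required to be integers; with real levels such as s'_n = s + 1/n, the limiting policy need not order at s and the claim can fail. *)

theory Defs
  imports "HOL-Probability.Probability"
begin

text \<open>
  Both variants of the model (real states and actions, integer states and natural number actions)
  are embedded into the reals: the state and action sets are subsets of the reals, with the Borel
  sigma-algebra restricted to them. On the integers this is the discrete sigma-algebra, and
  continuity and convergence relative to the state set are then trivial.
\<close>

record 'a inventory =
  demand_space :: "'a measure"
  demand :: "nat \<Rightarrow> 'a \<Rightarrow> real"
  states :: "real set"
  actions :: "real set"
  order_cost :: real
  unit_cost :: real
  holding :: "real \<Rightarrow> real"

text \<open>The demands are \<open>demand I 1, demand I 2, \<dots>\<close>; index 0 is not used. The generic demand
  \<open>D\<close> is \<open>demand I 1\<close>, and \<open>mean_after_demand I g x\<close> is \<open>E[g(x - D)]\<close>.\<close>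

definition mean_after_demand :: "'a inventory \<Rightarrow> (real \<Rightarrow> real) \<Rightarrow> real \<Rightarrow> real" where
  "mean_after_demand I g x = (\<integral>\<omega>. g (x - demand I 1 \<omega>) \<partial>demand_space I)"

definition mean_demand :: "'a inventory \<Rightarrow> real" where
  "mean_demand I = (\<integral>\<omega>. demand I 1 \<omega> \<partial>demand_space I)"

locale inventory_model = prob_space "demand_space I" for I :: "'a inventory" +
  assumes state_action_sets:
      "states I = UNIV \<and> actions I = {0..} \<or>
       states I = \<int> \<and> actions I = \<nat> \<and>
         (\<forall>n\<ge>1. \<forall>\<omega>\<in>space (demand_space I). demand I n \<omega> \<in> \<int>)"
    and order_cost_pos: "order_cost I > 0"
    and unit_cost_pos: "unit_cost I > 0"
    and demand_indep: "indep_vars (\<lambda>_. borel) (demand I) {1..}"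
    and demand_ident: "\<And>n. n \<ge> 1 \<Longrightarrow>
          distr (demand_space I) borel (demand I n) = distr (demand_space I) borel (demand I 1)"
    and demand_nonneg: "\<And>n \<omega>. n \<ge> 1 \<Longrightarrow> \<omega> \<in> space (demand_space I) \<Longrightarrow> demand I n \<omega> \<ge> 0"
    and demand_integrable: "integrable (demand_space I) (demand I 1)"
    and demand_pos: "prob {\<omega> \<in> space (demand_space I). demand I 1 \<omega> > 0} > 0"
    and holding_integrable: "\<And>x. x \<in> states I \<Longrightarrow>
          integrable (demand_space I) (\<lambda>\<omega>. holding I (x - demand I 1 \<omega>))"
    and holding_continuous: "continuous_on (states I) (mean_after_demand I (holding I))"
    and holding_nonneg: "\<And>x. x \<in> states I \<Longrightarrow> mean_after_demand I (holding I) x \<ge> 0"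
    and holding_coercive:
      "filterlim (mean_after_demand I (holding I)) at_top (inf at_infinity (principal (states I)))"

definition stage_cost :: "'a inventory \<Rightarrow> real \<Rightarrow> real \<Rightarrow> real" where
  "stage_cost I x a =
     (if a > 0 then order_cost I else 0) + unit_cost I * a + mean_after_demand I (holding I) (x + a)"

subsection \<open>Policies and strategic measures\<close>

definition state_space :: "'a inventory \<Rightarrow> real measure" where
  "state_space I = restrict_space borel (states I)"

definition action_space :: "'a inventory \<Rightarrow> real measure" where
  "action_space I = restrict_space borel (actions I)"

definition stage_space :: "'a inventory \<Rightarrow> (real \<times> real) measure" where
  "stage_space I = state_space I \<Otimes>\<^sub>M action_space I"

text \<open>A policy is a sequence of transition probabilities from histories to actions. The history
  \<open>(x\<^sub>0, a\<^sub>0, \<dots>, x\<^bsub>t-1\<^esub>, a\<^bsub>t-1\<^esub>, x\<^sub>t)\<close> is passed as the function \<open>\<omega>\<close> on \<open>{0..<t}\<close> with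
  \<open>\<omega> i = (x\<^sub>i, a\<^sub>i)\<close>, followed by the current state \<open>x\<^sub>t\<close>.\<close>

type_synonym policy = "nat \<Rightarrow> (nat \<Rightarrow> real \<times> real) \<Rightarrow> real \<Rightarrow> real measure"

definition policies :: "'a inventory \<Rightarrow> policy set" where
  "policies I = {\<pi>. \<forall>t. (\<lambda>(\<omega>, x). \<pi> t \<omega> x) \<in>
     PiM {0..<t} (\<lambda>_. stage_space I) \<Otimes>\<^sub>M state_space I \<rightarrow>\<^sub>M prob_algebra (action_space I)}"

fun next_state :: "'a inventory \<Rightarrow> real \<Rightarrow> nat \<Rightarrow> (nat \<Rightarrow> real \<times> real) \<Rightarrow> real measure" where
  "next_state I x\<^sub>0 0 \<omega> = return (state_space I) x\<^sub>0"
| "next_state I x\<^sub>0 (Suc t) \<omega> =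
     distr (demand_space I) (state_space I) (\<lambda>d. fst (\<omega> t) + snd (\<omega> t) - demand I (Suc t) d)"

definition stage_kernel ::
  "'a inventory \<Rightarrow> policy \<Rightarrow> real \<Rightarrow> nat \<Rightarrow> (nat \<Rightarrow> real \<times> real) \<Rightarrow> (real \<times> real) measure" where
  "stage_kernel I \<pi> x\<^sub>0 t \<omega> =
     next_state I x\<^sub>0 t \<omega> \<bind> (\<lambda>x. \<pi> t \<omega> x \<bind> (\<lambda>a. return (stage_space I) (x, a)))"

text \<open>The measure on trajectories \<open>i \<mapsto> (x\<^sub>i, a\<^sub>i)\<close> given by the Ionescu-Tulcea theorem. The kernel
  at time \<open>t + 1\<close> uses only the marginal distribution of \<open>demand I (t + 1)\<close>, so this demand is
  independent of the history under the measure.\<close>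

definition trajectories :: "'a inventory \<Rightarrow> policy \<Rightarrow> real \<Rightarrow> (nat \<Rightarrow> real \<times> real) measure" where
  "trajectories I \<pi> x\<^sub>0 =
     projective_family.lim UNIV
       (Ionescu_Tulcea.CI (stage_kernel I \<pi> x\<^sub>0) (\<lambda>_. stage_space I)) (\<lambda>_. stage_space I)"

subsection \<open>Optimality criteria\<close>

text \<open>Stage costs are nonnegative, so that values are taken in the extended nonnegative reals.\<close>

definition discounted_cost :: "'a inventory \<Rightarrow> real \<Rightarrow> policy \<Rightarrow> real \<Rightarrow> ennreal" where
  "discounted_cost I \<alpha> \<pi> x =
     (\<integral>\<^sup>+\<omega>. (\<Sum>t. ennreal (\<alpha> ^ t * stage_cost I (fst (\<omega> t)) (snd (\<omega> t)))) \<partial>trajectories I \<pi> x)"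

definition discounted_value :: "'a inventory \<Rightarrow> real \<Rightarrow> real \<Rightarrow> ennreal" where
  "discounted_value I \<alpha> x = (INF \<pi>\<in>policies I. discounted_cost I \<alpha> \<pi> x)"

definition discounted_optimal :: "'a inventory \<Rightarrow> real \<Rightarrow> policy \<Rightarrow> bool" where
  "discounted_optimal I \<alpha> \<pi> \<longleftrightarrow>
     \<pi> \<in> policies I \<and> (\<forall>x\<in>states I. discounted_cost I \<alpha> \<pi> x = discounted_value I \<alpha> x)"

definition min_value :: "'a inventory \<Rightarrow> real \<Rightarrow> ennreal" where
  "min_value I \<alpha> = (INF x\<in>states I. discounted_value I \<alpha> x)"

text \<open>The subtraction is not truncated for states \<open>x\<close>, as the subtrahend is a lower bound.\<close>

definition relative_value :: "'a inventory \<Rightarrow> real \<Rightarrow> real \<Rightarrow> ennreal" where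
  "relative_value I \<alpha> x = discounted_value I \<alpha> x - min_value I \<alpha>"

definition limit_min_value :: "'a inventory \<Rightarrow> ennreal" where
  "limit_min_value I = Lim (at_left 1) (\<lambda>\<alpha>. ennreal (1 - \<alpha>) * min_value I \<alpha>)"

definition average_cost :: "'a inventory \<Rightarrow> policy \<Rightarrow> real \<Rightarrow> ennreal" where
  "average_cost I \<pi> x =
     limsup (\<lambda>N. ennreal (1 / real N) *
       (\<integral>\<^sup>+\<omega>. (\<Sum>t<N. ennreal (stage_cost I (fst (\<omega> t)) (snd (\<omega> t)))) \<partial>trajectories I \<pi> x))"

definition average_optimal :: "'a inventory \<Rightarrow> policy \<Rightarrow> bool" where
  "average_optimal I \<pi> \<longleftrightarrow>
     \<pi> \<in> policies I \<and> (\<forall>x\<in>states I. average_cost I \<pi> x = (INF \<pi>'\<in>policies I. average_cost I \<pi>' x))"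

subsection \<open>Threshold policies, and the functions in the theorem\<close>

definition sS_action :: "real \<Rightarrow> real \<Rightarrow> real \<Rightarrow> real" where
  "sS_action s S x = (if x < s then S - x else 0)"

definition sS_policy :: "'a inventory \<Rightarrow> real \<Rightarrow> real \<Rightarrow> policy" where
  "sS_policy I s S = (\<lambda>t \<omega> x. return (action_space I) (sS_action s S x))"

definition discounted_holding :: "'a inventory \<Rightarrow> real \<Rightarrow> real \<Rightarrow> real" where
  "discounted_holding I \<alpha> x =
     holding I x + (1 - \<alpha>) * unit_cost I * x + unit_cost I * mean_demand I"

definition quasiconvex_on :: "real set \<Rightarrow> (real \<Rightarrow> real) \<Rightarrow> bool" where
  "quasiconvex_on X f \<longleftrightarrow>
     (\<forall>x\<in>X. \<forall>y\<in>X. \<forall>l\<in>{0..1}. l * x + (1 - l) * y \<in> X \<longrightarrow>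
        f (l * x + (1 - l) * y) \<le> max (f x) (f y))"

text \<open>For a sequence \<open>\<beta>\<close> of discount factors, the greatest lower bound of
  \<open>liminf\<^sub>k u\<^bsub>\<beta> k\<^esub> (y\<^sub>k)\<close> over all sequences of states \<open>y\<^sub>k \<longlonglongrightarrow> x\<close>.\<close>

definition liminf_relative_value :: "'a inventory \<Rightarrow> (nat \<Rightarrow> real) \<Rightarrow> real \<Rightarrow> ennreal" where
  "liminf_relative_value I \<beta> x =
     (INF y\<in>{y. (\<forall>k. y k \<in> states I) \<and> y \<longlonglongrightarrow> x}. liminf (\<lambda>k. relative_value I (\<beta> k) (y k)))"

definition H_function :: "'a inventory \<Rightarrow> (real \<Rightarrow> ennreal) \<Rightarrow> real \<Rightarrow> ereal" where
  "H_function I u x =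
     ereal (unit_cost I * x + mean_after_demand I (holding I) x)
       + enn2ereal (\<integral>\<^sup>+\<omega>. u (x - demand I 1 \<omega>) \<partial>demand_space I)"

end

theory Submission
  imports Defs
begin

text \<open>
  For deterministic Markov policies the Ionescu-Tulcea measure yields the usual recursion for
  expected costs, so the value function \<open>v\<close> of an optimal \<open>(s, S)\<close> policy satisfies the evaluation
  equation and cannot be improved by a deviation in the first step. Comparing with ordering up to a
  nearly minimal state \<open>y\<close>, which by coercivity stays in a fixed bounded set, bounds \<open>S\<close> from above.
  Since \<open>v(s - D) \<ge> v(s)\<close>, not ordering in state \<open>s\<close> gives \<open>E[h(s - D)] \<le> (1 - \<alpha>) v(s)\<close>, hence
  \<open>E[h(s - D)] + (1 - \<alpha>) c s\<close> is bounded, and the limit condition at \<open>-\<infinity>\<close> bounds \<open>s\<close> from below.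
  The relative values are bounded pointwise, uniformly in the discount factor, by an explicit
  supersolution of the renewal inequality for not ordering.

  The optimality inequality follows from the evaluation equation by Fatou's lemma; at the threshold
  itself a state \<open>y\<^sub>k < s\<^sub>k\<close> is replaced by \<open>s\<^sub>k\<close>, which does not increase the value. Iterating it shows
  that the limiting policy has average cost at most \<open>lim (1 - \<alpha>\<^sub>k) m\<close> along the subsequence, whereas
  by an Abelian argument every such limit is a lower bound for the average cost of every policy.
  Hence all these limits agree with \<open>w\<close>, and the limiting policy is optimal.
\<close>

subsection \<open>Measurability of the model\<close>

text \<open>\<open>discounted_value\<close> is an infimum over all randomized history-dependent
  policies, and no optimality equation is derived for it. All knowledge of it comes from two facts:
  the cost of the given optimal threshold policy satisfies an evaluation equation, and one deviation
  followed by that policy is again a policy. Both concern deterministic Markov policies, so the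
  trajectory measure is computed only for these. Arbitrary policies enter only in the lower bound on
  average costs, where nothing but their sequence of expected stage costs matters. The constants
  must not depend on the discount factor although values may grow like
  \<open>1 / (1 - \<beta>)\<close>; so the estimates aim at the scaled least value and at
  differences from the least value. The limit in \<open>limit_min_value\<close> is taken with
  \<open>Lim\<close>, so that its existence has to be proved before anything can be said about it.
  Taking lower limits over all sequences \<open>y k\<close> tending to \<open>x\<close>, and not
  only over constant ones, makes the limit function lower semicontinuous. This gives its
  measurability, Fatou's lemma with moving arguments, and minimizers of \<open>H\<close>.\<close>

context inventory_model
begin

abbreviation "X \<equiv> states I"
abbreviation "A \<equiv> actions I"
abbreviation "K \<equiv> order_cost I"
abbreviation "c \<equiv> unit_cost I"
abbreviation "D \<equiv> demand I 1"
abbreviation "L \<equiv> mean_after_demand I (holding I)"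

lemma states_cases:
  obtains "X = UNIV" "A = {0..}"
  | "X = \<int>" "A = \<nat>" "\<And>n \<omega>. n \<ge> 1 \<Longrightarrow> \<omega> \<in> space (demand_space I) \<Longrightarrow> demand I n \<omega> \<in> \<int>"
  using state_action_sets by blast

lemma closed_states: "closed X"
  using states_cases by (metis closed_UNIV closed_Ints)

lemma closed_actions: "closed A"
  using states_cases closed_atLeast closed_Nats by metis

lemma states_borel [measurable]: "X \<in> sets borel"
  using closed_states by simp

lemma demand_measurable [measurable]: "n \<ge> 1 \<Longrightarrow> demand I n \<in> borel_measurable (demand_space I)"
  using demand_indep unfolding indep_vars_def by auto

lemma state_diff: "x \<in> X \<Longrightarrow> n \<ge> 1 \<Longrightarrow> \<omega> \<in> space (demand_space I) \<Longrightarrow> x - demand I n \<omega> \<in> X"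
  by (cases rule: states_cases) auto

lemma state_add: "x \<in> X \<Longrightarrow> a \<in> A \<Longrightarrow> x + a \<in> X"
  by (cases rule: states_cases) (auto elim!: Nats_cases)

text \<open>Ordering up to a level is handled through this equivalence, so that later arguments
  rarely distinguish real from integer states.\<close>

lemma action_iff: "x \<in> X \<Longrightarrow> y \<in> X \<Longrightarrow> y - x \<in> A \<longleftrightarrow> x \<le> y"
  by (cases rule: states_cases)
     (auto simp: Nats_altdef2)

lemma zero_state [simp]: "0 \<in> X"
  by (cases rule: states_cases) auto

lemma zero_action [simp]: "0 \<in> A"
  by (cases rule: states_cases) auto

lemma action_nonneg: "a \<in> A \<Longrightarrow> a \<ge> 0"
  by (cases rule: states_cases) (auto elim!: Nats_cases)

lemma space_state_space [simp]: "space (state_space I) = X"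
  by (simp add: state_space_def space_restrict_space)

lemma space_action_space [simp]: "space (action_space I) = A"
  by (simp add: action_space_def space_restrict_space)

lemma measurable_state_spaceI:
  "f \<in> borel_measurable M \<Longrightarrow> (\<And>x. x \<in> space M \<Longrightarrow> f x \<in> X) \<Longrightarrow> f \<in> M \<rightarrow>\<^sub>M state_space I"
  unfolding state_space_def by (rule measurable_restrict_space2) auto

lemma measurable_action_spaceI:
  "f \<in> borel_measurable M \<Longrightarrow> (\<And>x. x \<in> space M \<Longrightarrow> f x \<in> A) \<Longrightarrow> f \<in> M \<rightarrow>\<^sub>M action_space I"
  unfolding action_space_def by (rule measurable_restrict_space2) auto

lemma borel_measurable_state_space: "f \<in> borel_measurable borel \<Longrightarrow> f \<in> borel_measurable (state_space I)"
  unfolding state_space_def by (rule measurable_restrict_space1)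

lemma state_ident [measurable]: "(\<lambda>x. x) \<in> borel_measurable (state_space I)"
  by (rule borel_measurable_state_space) simp

lemma action_ident [measurable]: "(\<lambda>x. x) \<in> borel_measurable (action_space I)"
  unfolding action_space_def by (rule measurable_restrict_space1) simp

lemma fst_stage [measurable]: "fst \<in> borel_measurable (stage_space I)"
  using measurable_compose[OF measurable_fst state_ident] by (simp add: stage_space_def)

lemma snd_stage [measurable]: "snd \<in> borel_measurable (stage_space I)"
  using measurable_compose[OF measurable_snd action_ident] by (simp add: stage_space_def)

lemma space_stage_space: "space (stage_space I) = X \<times> A"
  by (simp add: stage_space_def space_pair_measure)

lemma next_stage_measurable [measurable]: "(\<lambda>p. fst p + snd p) \<in> stage_space I \<rightarrow>\<^sub>M state_space I"
  by (rule measurable_state_spaceI) (auto simp: space_stage_space state_add)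

lemma component_stage [measurable]:
  "t \<in> J \<Longrightarrow> (\<lambda>\<omega>. \<omega> t) \<in> PiM J (\<lambda>_. stage_space I) \<rightarrow>\<^sub>M stage_space I"
  by (rule measurable_component_singleton)

lemma L_measurable [measurable]: "L \<in> borel_measurable (state_space I)"
  unfolding state_space_def using holding_continuous by (rule borel_measurable_continuous_on_restrict)

lemma stage_cost_measurable [measurable]:
  "(\<lambda>p. stage_cost I (fst p) (snd p)) \<in> borel_measurable (stage_space I)"
  unfolding stage_cost_def by measurable

lemma stage_cost_nonneg: "x \<in> X \<Longrightarrow> a \<in> A \<Longrightarrow> stage_cost I x a \<ge> 0"
  unfolding stage_cost_def
  using order_cost_pos unit_cost_pos holding_nonneg[OF state_add] action_nonneg by auto

lemma subtract_demand_measurable: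
  "n \<ge> 1 \<Longrightarrow> x \<in> X \<Longrightarrow> (\<lambda>\<omega>. x - demand I n \<omega>) \<in> demand_space I \<rightarrow>\<^sub>M state_space I"
  by (rule measurable_state_spaceI) (auto intro: state_diff)

lemma subtract_demand_pair_measurable:
  "n \<ge> 1 \<Longrightarrow> (\<lambda>(x, \<omega>). x - demand I n \<omega>) \<in> state_space I \<Otimes>\<^sub>M demand_space I \<rightarrow>\<^sub>M state_space I"
  by (rule measurable_state_spaceI) (auto simp: space_pair_measure intro: state_diff)

lemma next_state_measurable:
  assumes "x\<^sub>0 \<in> X"
  shows "next_state I x\<^sub>0 t \<in> PiM {0..<t} (\<lambda>_. stage_space I) \<rightarrow>\<^sub>M prob_algebra (state_space I)"
proof (cases t)
  case 0
  have "return (state_space I) x\<^sub>0 \<in> space (prob_algebra (state_space I))"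
    using assms by (auto simp: space_prob_algebra intro!: prob_space_return)
  moreover have "next_state I x\<^sub>0 0 = (\<lambda>\<omega>. return (state_space I) x\<^sub>0)"
    by (rule ext) simp
  ultimately show ?thesis using 0 by (simp add: measurable_const)
next
  case (Suc n)
  have *: "(\<lambda>\<omega>. fst (\<omega> n) + snd (\<omega> n)) \<in> PiM {0..<Suc n} (\<lambda>_. stage_space I) \<rightarrow>\<^sub>M state_space I"
    by measurable
  have "(\<lambda>\<omega>. distr (demand_space I) (state_space I) (\<lambda>d. fst (\<omega> n) + snd (\<omega> n) - demand I (Suc n) d))
     \<in> PiM {0..<Suc n} (\<lambda>_. stage_space I) \<rightarrow>\<^sub>M prob_algebra (state_space I)"
  proof (rule measurable_distr_prob_space2[where M="demand_space I"])
    show "(\<lambda>\<omega>. demand_space I) \<in> PiM {0..<Suc n} (\<lambda>_. stage_space I) \<rightarrow>\<^sub>M prob_algebra (demand_space I)"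
      by (intro measurable_const) (simp add: space_prob_algebra prob_space_axioms)
    have "(\<lambda>(\<omega>, d). (\<lambda>(x,\<omega>). x - demand I (Suc n) \<omega>) (fst (\<omega> n) + snd (\<omega> n), d))
      \<in> PiM {0..<Suc n} (\<lambda>_. stage_space I) \<Otimes>\<^sub>M demand_space I \<rightarrow>\<^sub>M state_space I"
      by (subst case_prod_beta', rule measurable_compose[OF _ subtract_demand_pair_measurable])
         (use * in measurable)
    then show "(\<lambda>(\<omega>, d). fst (\<omega> n) + snd (\<omega> n) - demand I (Suc n) d)
      \<in> PiM {0..<Suc n} (\<lambda>_. stage_space I) \<Otimes>\<^sub>M demand_space I \<rightarrow>\<^sub>M state_space I"
      by simp
  qed
  moreover have "next_state I x\<^sub>0 (Suc n) =
     (\<lambda>\<omega>. distr (demand_space I) (state_space I) (\<lambda>d. fst (\<omega> n) + snd (\<omega> n) - demand I (Suc n) d))"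
    by (rule ext) simp
  ultimately show ?thesis using Suc by simp
qed

lemma stage_kernel_measurable:
  assumes "x\<^sub>0 \<in> X" "\<pi> \<in> policies I"
  shows "stage_kernel I \<pi> x\<^sub>0 t \<in> PiM {0..<t} (\<lambda>_. stage_space I) \<rightarrow>\<^sub>M prob_algebra (stage_space I)"
  unfolding stage_kernel_def
proof (rule measurable_bind_prob_space2[OF next_state_measurable[OF assms(1)]])
  let ?M = "PiM {0..<t} (\<lambda>_. stage_space I) \<Otimes>\<^sub>M state_space I"
  have "(\<lambda>(\<omega>, x). \<pi> t \<omega> x) \<in> ?M \<rightarrow>\<^sub>M prob_algebra (action_space I)"
    using assms(2) by (simp add: policies_def)
  moreover have "(\<lambda>(p, a). return (stage_space I) (snd p, a)) \<in> ?M \<Otimes>\<^sub>M action_space I \<rightarrow>\<^sub>M prob_algebra (stage_space I)"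
    unfolding case_prod_beta'
    by (rule measurable_compose[OF _ measurable_return_prob_space]) (simp add: stage_space_def)
  ultimately have "(\<lambda>p. (\<lambda>(\<omega>, x). \<pi> t \<omega> x) p \<bind> (\<lambda>a. return (stage_space I) (snd p, a))) \<in> ?M \<rightarrow>\<^sub>M prob_algebra (stage_space I)"
    by (rule measurable_bind_prob_space2)
  then show "(\<lambda>(\<omega>, x). \<pi> t \<omega> x \<bind> (\<lambda>a. return (stage_space I) (x, a))) \<in> ?M \<rightarrow>\<^sub>M prob_algebra (stage_space I)"
    by (simp add: case_prod_beta')
qed

lemma Ionescu_Tulcea_kernel:
  assumes "x\<^sub>0 \<in> X" "\<pi> \<in> policies I"
  shows "Ionescu_Tulcea (stage_kernel I \<pi> x\<^sub>0) (\<lambda>_. stage_space I)"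
proof (rule Ionescu_Tulcea.intro)
  show "stage_kernel I \<pi> x\<^sub>0 i \<in> PiM {0..<i} (\<lambda>_. stage_space I) \<rightarrow>\<^sub>M subprob_algebra (stage_space I)" for i
    using stage_kernel_measurable[OF assms] by (rule measurable_prob_algebraD)
  show "prob_space (stage_kernel I \<pi> x\<^sub>0 i \<omega>)" if "\<omega> \<in> space (PiM {0..<i} (\<lambda>_. stage_space I))" for i \<omega>
    using measurable_space[OF stage_kernel_measurable[OF assms] that] by (simp add: space_prob_algebra)
qed

lemma sets_trajectories:
  assumes "x\<^sub>0 \<in> X" "\<pi> \<in> policies I"
  shows "sets (trajectories I \<pi> x\<^sub>0) = sets (PiM UNIV (\<lambda>_. stage_space I))"
proof -
  interpret Ionescu_Tulcea "stage_kernel I \<pi> x\<^sub>0" "\<lambda>_. stage_space I"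
    by (rule Ionescu_Tulcea_kernel[OF assms])
  show ?thesis unfolding trajectories_def by (rule PF.sets_lim)
qed

end

section \<open>Marginals of the Ionescu-Tulcea measure\<close>

lemma (in Ionescu_Tulcea) nn_integral_C_upto:
  assumes "n \<le> n'" and g: "g \<in> borel_measurable (PiM {0..<n} M)"
  shows "(\<integral>\<^sup>+x. g x \<partial>C 0 n (\<lambda>x. undefined)) = (\<integral>\<^sup>+x. g (restrict x {0..<n}) \<partial>C 0 n' (\<lambda>x. undefined))"
  using nn_integral_C[of n n' g 0 "\<lambda>x. undefined"] assms by simp

text \<open>The projective limit restricts to \<open>CI {0..<n}\<close>, which is itself a
  projection of a finite composition of kernels; for an initial segment of times nothing is
  projected away.\<close>

lemma (in Ionescu_Tulcea) nn_integral_lim_restrict: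
  assumes g: "g \<in> borel_measurable (PiM {0..<n} M)"
  shows "(\<integral>\<^sup>+\<omega>. g (restrict \<omega> {0..<n}) \<partial>PF.lim) = (\<integral>\<^sup>+\<omega>. g \<omega> \<partial>C 0 n (\<lambda>x. undefined))"
proof -
  have m: "(\<lambda>\<omega>. restrict \<omega> {0..<n}) \<in> PF.lim \<rightarrow>\<^sub>M PiM {0..<n} M"
    by (subst measurable_cong_sets[OF PF.sets_lim refl]) (rule measurable_restrict_subset, simp)
  \<comment> \<open>\<open>CI J\<close> is the image of the composition of the first
    \<open>up_to J\<close> kernels, where \<open>up_to J\<close> is the least index beyond all of
    \<open>J\<close>.\<close>
  have up: "up_to {0..<n} = n"
    by (metis antisym finite_atLeastLessThan lessThan_atLeast0 lessThan_subset_iff order_refl up_to up_to_iff_Ico)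
  have rm: "(\<lambda>f. restrict f {0..<n}) \<in> C 0 n (\<lambda>x. undefined) \<rightarrow>\<^sub>M PiM {0..<n} M"
    by (subst measurable_cong_sets[OF sets_C refl]) (auto intro!: measurable_restrict_subset)
  have "(\<integral>\<^sup>+\<omega>. g (restrict \<omega> {0..<n}) \<partial>PF.lim) = (\<integral>\<^sup>+\<omega>. g \<omega> \<partial>distr PF.lim (PiM {0..<n} M) (\<lambda>\<omega>. restrict \<omega> {0..<n}))"
    using g m by (simp add: nn_integral_distr)
  also have "\<dots> = (\<integral>\<^sup>+\<omega>. g \<omega> \<partial>CI {0..<n})"
    by (simp add: distr_lim)
  also have "\<dots> = (\<integral>\<^sup>+\<omega>. g (restrict \<omega> {0..<n}) \<partial>C 0 n (\<lambda>x. undefined))"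
    using g rm by (simp add: CI_def up nn_integral_distr)
  also have "\<dots> = (\<integral>\<^sup>+\<omega>. g \<omega> \<partial>C 0 n (\<lambda>x. undefined))"
    using nn_integral_C_upto[OF order_refl g] by simp
  finally show ?thesis .
qed

text \<open>Conditioning on the history before time \<open>n\<close>: the composition of
  \<open>Suc n\<close> kernels is that of \<open>n\<close> kernels followed by \<open>P n\<close>.
  The restriction on the right is there because \<open>P n\<close> takes histories on
  \<open>{0..<n}\<close> and not whole trajectories.\<close>

lemma (in Ionescu_Tulcea) nn_integral_lim_component:
  assumes g: "g \<in> borel_measurable (M n)"
  shows "(\<integral>\<^sup>+\<omega>. g (\<omega> n) \<partial>PF.lim) = (\<integral>\<^sup>+\<omega>. (\<integral>\<^sup>+x. g x \<partial>P n (restrict \<omega> {0..<n})) \<partial>PF.lim)"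
proof -
  note g[measurable]
  have gn: "(\<lambda>\<omega>. g (\<omega> n)) \<in> borel_measurable (PiM {0..<Suc n} M)"
    by measurable
  have "(\<integral>\<^sup>+\<omega>. g (\<omega> n) \<partial>PF.lim) = (\<integral>\<^sup>+\<omega>. g (restrict \<omega> {0..<Suc n} n) \<partial>PF.lim)"
    by simp
  also have "\<dots> = (\<integral>\<^sup>+\<omega>. g (\<omega> n) \<partial>C 0 (Suc n) (\<lambda>x. undefined))"
    by (rule nn_integral_lim_restrict[OF gn])
  also have "\<dots> = (\<integral>\<^sup>+\<omega>. (\<integral>\<^sup>+x. g (x n) \<partial>eP n \<omega>) \<partial>C 0 n (\<lambda>x. undefined))"
  proof -
    have "sets (C 0 n (\<lambda>x. undefined)) = sets (PiM {0..<n} M)"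
      using sets_C[of "\<lambda>x. undefined" 0 n] by simp
    then have "eP n \<in> C 0 n (\<lambda>x. undefined) \<rightarrow>\<^sub>M subprob_algebra (PiM {0..<Suc n} M)"
      using measurable_eP[of n] measurable_cong_sets by blast
    then show ?thesis
      using gn by (simp, subst nn_integral_bind[where B="PiM {0..<Suc n} M"]) auto
  qed
  also have "\<dots> = (\<integral>\<^sup>+\<omega>. (\<integral>\<^sup>+x. g x \<partial>P n \<omega>) \<partial>C 0 n (\<lambda>x. undefined))"
    by (intro nn_integral_cong) (simp add: space_C nn_integral_eP gn)
  also have "\<dots> = (\<integral>\<^sup>+\<omega>. (\<integral>\<^sup>+x. g x \<partial>P n (restrict \<omega> {0..<n})) \<partial>PF.lim)"
    by (rule nn_integral_lim_restrict[symmetric]) measurable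
  finally show ?thesis .
qed

subsection \<open>Markov policies and finite-horizon costs\<close>

context inventory_model
begin

text \<open>The simplifier must not rewrite the index in \<open>demand I 1\<close> to \<open>Suc 0\<close>.\<close>

declare One_nat_def [simp del]

text \<open>The rule may vary with time, so that a deviation in the first stage followed by a
  threshold policy is also of this form.\<close>

definition markov_policy :: "(nat \<Rightarrow> real \<Rightarrow> real) \<Rightarrow> policy" where
  "markov_policy f = (\<lambda>t \<omega> x. return (action_space I) (f t x))"

definition decision_rules :: "(nat \<Rightarrow> real \<Rightarrow> real) set" where
  "decision_rules = {f. \<forall>t. f t \<in> state_space I \<rightarrow>\<^sub>M action_space I}"

definition demand_mean :: "(real \<Rightarrow> ennreal) \<Rightarrow> real \<Rightarrow> ennreal" where
  "demand_mean g x = (\<integral>\<^sup>+\<omega>. g (x - D \<omega>) \<partial>demand_space I)"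

text \<open>The expectation of \<open>g\<close> at the state of time \<open>t\<close>. The recursion
  splits off the first stage, as value functions require, and therefore shifts the sequence of
  decision rules.\<close>

fun stage_mean :: "(nat \<Rightarrow> real \<Rightarrow> real) \<Rightarrow> nat \<Rightarrow> (real \<Rightarrow> ennreal) \<Rightarrow> real \<Rightarrow> ennreal" where
  "stage_mean f 0 g x = g x"
| "stage_mean f (Suc t) g x = demand_mean (stage_mean (f \<circ> Suc) t g) (x + f 0 x)"

lemma decision_rule_measurable: "f \<in> decision_rules \<Longrightarrow> f t \<in> state_space I \<rightarrow>\<^sub>M action_space I"
  by (simp add: decision_rules_def)

lemma decision_rule_action: "f \<in> decision_rules \<Longrightarrow> x \<in> X \<Longrightarrow> f t x \<in> A"
  using measurable_space[OF decision_rule_measurable, of f x t] by simp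

lemma order_state: "f \<in> decision_rules \<Longrightarrow> x \<in> X \<Longrightarrow> x + f t x \<in> X"
  by (intro state_add decision_rule_action[of f])

lemma decision_rules_Suc: "f \<in> decision_rules \<Longrightarrow> f \<circ> Suc \<in> decision_rules"
  by (simp add: decision_rules_def)

lemma markov_policies: 
  assumes "f \<in> decision_rules"
  shows "markov_policy f \<in> policies I"
  unfolding policies_def markov_policy_def case_prod_beta'
proof (intro CollectI allI)
  fix t
  have "(\<lambda>p. f t (snd p)) \<in> PiM {0..<t} (\<lambda>_. stage_space I) \<Otimes>\<^sub>M state_space I \<rightarrow>\<^sub>M action_space I"
    by (rule measurable_compose[OF measurable_snd decision_rule_measurable[OF assms]])
  then show "(\<lambda>p. return (action_space I) (f t (snd p)))
       \<in> PiM {0..<t} (\<lambda>_. stage_space I) \<Otimes>\<^sub>M state_space I \<rightarrow>\<^sub>M prob_algebra (action_space I)"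
    by (rule measurable_compose[OF _ measurable_return_prob_space])
qed

lemma demand_mean_cong: "(\<And>y. y \<in> X \<Longrightarrow> g y = g' y) \<Longrightarrow> x \<in> X \<Longrightarrow> demand_mean g x = demand_mean g' x"
  unfolding demand_mean_def by (intro nn_integral_cong) (auto intro: state_diff)

lemma demand_mean_mono: "(\<And>y. y \<in> X \<Longrightarrow> y \<le> x \<Longrightarrow> g y \<le> g' y) \<Longrightarrow> x \<in> X \<Longrightarrow> demand_mean g x \<le> demand_mean g' x"
  unfolding demand_mean_def by (intro nn_integral_mono) (simp add: state_diff demand_nonneg)

lemma demand_mean_measurable [measurable]:
  assumes "g \<in> borel_measurable (state_space I)"
  shows "demand_mean g \<in> borel_measurable (state_space I)"
proof -
  have "(\<lambda>(x, \<omega>). g (x - D \<omega>)) \<in> borel_measurable (state_space I \<Otimes>\<^sub>M demand_space I)"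
    using measurable_compose[OF subtract_demand_pair_measurable assms, of 1]
    by (simp add: case_prod_beta')
  then show ?thesis
    unfolding demand_mean_def by (rule borel_measurable_nn_integral)
qed

lemma order_measurable: "f \<in> decision_rules \<Longrightarrow> (\<lambda>x. x + f t x) \<in> state_space I \<rightarrow>\<^sub>M state_space I"
proof (rule measurable_state_spaceI)
  assume f: "f \<in> decision_rules"
  have "f t \<in> borel_measurable (state_space I)"
    using measurable_compose[OF decision_rule_measurable[OF f] action_ident] .
  then show "(\<lambda>x. x + f t x) \<in> borel_measurable (state_space I)"
    by (intro borel_measurable_add state_ident)
qed (simp add: order_state)

lemma stage_mean_measurable [measurable]:
  "f \<in> decision_rules \<Longrightarrow> g \<in> borel_measurable (state_space I) \<Longrightarrow>
     stage_mean f t g \<in> borel_measurable (state_space I)"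
proof (induction t arbitrary: f)
  case (Suc t)
  have "(\<lambda>x. demand_mean (stage_mean (f \<circ> Suc) t g) (x + f 0 x)) \<in> borel_measurable (state_space I)"
    by (rule measurable_compose[OF order_measurable demand_mean_measurable[OF Suc.IH[OF decision_rules_Suc]]])
       (rule Suc.prems)+
  then show ?case by simp
qed (simp add: stage_mean.simps[abs_def])

text \<open>Splits off the last stage instead of the first; this is the order in which the
  trajectory measure is composed from its kernels.\<close>

lemma stage_mean_Suc_right:
  "stage_mean f (Suc t) g x = stage_mean f t (\<lambda>y. demand_mean g (y + f t y)) x"
proof (induction t arbitrary: f x)
  case (Suc t)
  have "stage_mean f (Suc (Suc t)) g x = demand_mean (stage_mean (f \<circ> Suc) (Suc t) g) (x + f 0 x)"
    by (rule stage_mean.simps)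
  also have "stage_mean (f \<circ> Suc) (Suc t) g = stage_mean (f \<circ> Suc) t (\<lambda>y. demand_mean g (y + (f \<circ> Suc) t y))"
    using Suc.IH by blast
  finally show ?case by simp
qed (simp add: stage_mean.simps[abs_def])

text \<open>The kernel leading to time \<open>n\<close> uses the demand of that period; identical
  distribution lets \<open>D\<close> replace it throughout.\<close>

lemma nn_integral_demand:
  assumes "n \<ge> 1" "x \<in> X" and g: "g \<in> borel_measurable (state_space I)"
  shows "(\<integral>\<^sup>+\<omega>. g (x - demand I n \<omega>) \<partial>demand_space I) = demand_mean g x"
proof -
  \<comment> \<open>\<open>g\<close> is measurable on the states only. Its extension by zero is
    Borel, so that the image measures of the demands on the whole line can be compared.\<close>
  let ?g = "\<lambda>y. g y * indicator X y"
  have g'[measurable]: "?g \<in> borel_measurable borel"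
    using g borel_measurable_restrict_space_iff_ennreal[of X borel g]
    by (simp add: state_space_def)
  have *: "(\<integral>\<^sup>+\<omega>. g (x - demand I m \<omega>) \<partial>demand_space I)
     = (\<integral>\<^sup>+d. ?g (x - d) \<partial>distr (demand_space I) borel (demand I m))" if "m \<ge> 1" for m
  proof -
    have "(\<integral>\<^sup>+\<omega>. g (x - demand I m \<omega>) \<partial>demand_space I) = (\<integral>\<^sup>+\<omega>. ?g (x - demand I m \<omega>) \<partial>demand_space I)"
      using that by (intro nn_integral_cong) (simp add: state_diff assms(2))
    also have "\<dots> = (\<integral>\<^sup>+d. ?g (x - d) \<partial>distr (demand_space I) borel (demand I m))"
      using that by (subst nn_integral_distr) auto
    finally show ?thesis .
  qed
  show ?thesis
    unfolding demand_mean_def using *[OF assms(1)] *[of 1] demand_ident[OF assms(1)] by simp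
qed

lemma nn_integral_stage_kernel:
  assumes f: "f \<in> decision_rules" and x: "x\<^sub>0 \<in> X" and \<omega>: "\<omega> \<in> space (PiM {0..<t} (\<lambda>_. stage_space I))"
    and G: "G \<in> borel_measurable (stage_space I)"
  shows "(\<integral>\<^sup>+p. G p \<partial>stage_kernel I (markov_policy f) x\<^sub>0 t \<omega>) = (\<integral>\<^sup>+x. G (x, f t x) \<partial>next_state I x\<^sub>0 t \<omega>)"
proof -
  have ns: "next_state I x\<^sub>0 t \<omega> \<in> space (prob_algebra (state_space I))"
    by (rule measurable_space[OF next_state_measurable[OF x] \<omega>])
  then have sets: "sets (next_state I x\<^sub>0 t \<omega>) = sets (state_space I)"
    by (simp add: space_prob_algebra)
  then have sp: "space (next_state I x\<^sub>0 t \<omega>) = X"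
    using sets_eq_imp_space_eq[OF sets] by simp
  have m: "(\<lambda>y. (y, f t y)) \<in> state_space I \<rightarrow>\<^sub>M stage_space I"
    unfolding stage_space_def using decision_rule_measurable[OF f] by simp
  have *: "return (action_space I) (f t y) \<bind> (\<lambda>a. return (stage_space I) (y, a)) = return (stage_space I) (y, f t y)"
    if "y \<in> X" for y
  proof (rule bind_return[where N="stage_space I"])
    have "(\<lambda>a. (y, a)) \<in> action_space I \<rightarrow>\<^sub>M stage_space I"
      unfolding stage_space_def using that by simp
    then show "(\<lambda>a. return (stage_space I) (y, a)) \<in> action_space I \<rightarrow>\<^sub>M subprob_algebra (stage_space I)"
      by (rule measurable_compose) (rule return_measurable)
  qed (use that f decision_rule_action in simp)
  have "stage_kernel I (markov_policy f) x\<^sub>0 t \<omega> = next_state I x\<^sub>0 t \<omega> \<bind> (\<lambda>y. return (stage_space I) (y, f t y))"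
    unfolding stage_kernel_def markov_policy_def using * sp
    by (intro bind_cong) auto
  also have "(\<integral>\<^sup>+p. G p \<partial>\<dots>) = (\<integral>\<^sup>+y. (\<integral>\<^sup>+p. G p \<partial>return (stage_space I) (y, f t y)) \<partial>next_state I x\<^sub>0 t \<omega>)"
  proof (rule nn_integral_bind[OF G])
    show "(\<lambda>y. return (stage_space I) (y, f t y)) \<in> next_state I x\<^sub>0 t \<omega> \<rightarrow>\<^sub>M subprob_algebra (stage_space I)"
      by (subst measurable_cong_sets[OF sets refl], rule measurable_compose[OF m return_measurable])
  qed
  also have "\<dots> = (\<integral>\<^sup>+x. G (x, f t x) \<partial>next_state I x\<^sub>0 t \<omega>)"
    using measurable_space[OF m] G sp by (intro nn_integral_cong nn_integral_return) auto
  finally show ?thesis .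
qed

text \<open>Induction on time for all integrands at once: conditioning on the history turns an
  integrand of stage \<open>t + 1\<close> into the integrand
  \<open>demand_mean g (fst p + snd p)\<close> of stage \<open>t\<close>.\<close>

lemma nn_integral_trajectories:
  assumes f: "f \<in> decision_rules" and x: "x\<^sub>0 \<in> X" and G: "G \<in> borel_measurable (stage_space I)"
  shows "(\<integral>\<^sup>+\<omega>. G (\<omega> t) \<partial>trajectories I (markov_policy f) x\<^sub>0) = stage_mean f t (\<lambda>y. G (y, f t y)) x\<^sub>0"
  using G
proof (induction t arbitrary: G)
  let ?P = "stage_kernel I (markov_policy f) x\<^sub>0" and ?M = "\<lambda>_::nat. stage_space I"
  interpret Ionescu_Tulcea ?P ?M
    by (rule Ionescu_Tulcea_kernel[OF x markov_policies[OF f]])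
  have T: "trajectories I (markov_policy f) x\<^sub>0 = PF.lim"
    unfolding trajectories_def ..
  have sp: "restrict \<omega> {0..<t} \<in> space (PiM {0..<t} ?M)" if "\<omega> \<in> space PF.lim" for \<omega> t
    using that by (auto simp: space_PiM PiE_iff)
  \<comment> \<open>The total mass is the integral of the constant 1 seen through the restriction to
    no coordinates at all.\<close>
  have prob: "prob_space PF.lim"
  proof
    have "emeasure PF.lim (space PF.lim) = (\<integral>\<^sup>+\<omega>. (\<lambda>_. 1) (restrict \<omega> {0..<0}) \<partial>PF.lim)"
      by simp
    also have "\<dots> = 1"
      using nn_integral_lim_restrict[of "\<lambda>_. 1" 0]
        prob_space.emeasure_space_1[OF prob_space_C[of "\<lambda>x. undefined" 0 0]] by simp
    finally show "emeasure PF.lim (space PF.lim) = 1" .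
  qed
  have m: "(\<lambda>y. (y, f t y)) \<in> state_space I \<rightarrow>\<^sub>M stage_space I" for t
    unfolding stage_space_def using decision_rule_measurable[OF f] by simp
  have step: "(\<integral>\<^sup>+\<omega>. G (\<omega> t) \<partial>PF.lim) = (\<integral>\<^sup>+\<omega>. (\<integral>\<^sup>+y. G (y, f t y) \<partial>next_state I x\<^sub>0 t (restrict \<omega> {0..<t})) \<partial>PF.lim)"
    if G: "G \<in> borel_measurable (stage_space I)" for G t
    by (subst nn_integral_lim_component[OF G], intro nn_integral_cong nn_integral_stage_kernel f x sp G) simp
  {
    case 0
    have "(\<integral>\<^sup>+y. G (y, f 0 y) \<partial>return (state_space I) x\<^sub>0) = G (x\<^sub>0, f 0 x\<^sub>0)"
      by (rule nn_integral_return) (use x measurable_compose[OF m 0] in auto)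
    then show ?case
      unfolding T step[OF 0] using prob_space.emeasure_space_1[OF prob] by simp
  next
    case (Suc t)
    define g where "g = (\<lambda>y. G (y, f (Suc t) y))"
    have g: "g \<in> borel_measurable (state_space I)"
      unfolding g_def by (rule measurable_compose[OF m Suc.prems])
    have "(\<integral>\<^sup>+\<omega>. G (\<omega> (Suc t)) \<partial>PF.lim) = (\<integral>\<^sup>+\<omega>. demand_mean g (fst (\<omega> t) + snd (\<omega> t)) \<partial>PF.lim)"
      unfolding step[OF Suc.prems] g_def[symmetric]
    proof (intro nn_integral_cong)
      fix \<omega> assume "\<omega> \<in> space PF.lim"
      then have "\<omega> t \<in> space (stage_space I)" by (auto simp: space_PiM PiE_iff)
      then have z: "fst (\<omega> t) + snd (\<omega> t) \<in> X"
        using measurable_space[OF next_stage_measurable] by simp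
      have "(\<integral>\<^sup>+y. g y \<partial>next_state I x\<^sub>0 (Suc t) (restrict \<omega> {0..<Suc t}))
         = (\<integral>\<^sup>+d. g (fst (\<omega> t) + snd (\<omega> t) - demand I (Suc t) d) \<partial>demand_space I)"
        using z g by (simp add: nn_integral_distr subtract_demand_measurable)
      also have "\<dots> = demand_mean g (fst (\<omega> t) + snd (\<omega> t))"
        by (rule nn_integral_demand[OF _ z g]) simp
      finally show "(\<integral>\<^sup>+y. g y \<partial>next_state I x\<^sub>0 (Suc t) (restrict \<omega> {0..<Suc t})) = demand_mean g (fst (\<omega> t) + snd (\<omega> t))" .
    qed
    also have "\<dots> = stage_mean f t (\<lambda>y. demand_mean g (y + f t y)) x\<^sub>0"
      using Suc.IH[of "\<lambda>p. demand_mean g (fst p + snd p)"]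
        measurable_compose[OF next_stage_measurable demand_mean_measurable[OF g]]
      by (simp add: T)
    also have "\<dots> = stage_mean f (Suc t) g x\<^sub>0"
      by (rule stage_mean_Suc_right[symmetric])
    finally show ?case
      unfolding T g_def .
  }
qed

text \<open>With \<open>\<beta> = 1\<close> these are the undiscounted sums behind the average cost,
  so one recursion serves both criteria.\<close>

definition horizon_cost :: "real \<Rightarrow> (nat \<Rightarrow> real \<Rightarrow> real) \<Rightarrow> nat \<Rightarrow> real \<Rightarrow> ennreal" where
  "horizon_cost \<beta> f N x =
     (\<Sum>t<N. ennreal (\<beta> ^ t) * stage_mean f t (\<lambda>y. ennreal (stage_cost I y (f t y))) x)"

lemma stage_cost_rule_measurable:
  assumes "f \<in> decision_rules"
  shows "(\<lambda>y. ennreal (stage_cost I y (f t y))) \<in> borel_measurable (state_space I)"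
proof -
  have "(\<lambda>y. (y, f t y)) \<in> state_space I \<rightarrow>\<^sub>M stage_space I"
    unfolding stage_space_def using decision_rule_measurable[OF assms] by simp
  from measurable_compose[OF measurable_compose[OF this stage_cost_measurable] measurable_ennreal]
  show ?thesis by simp
qed

lemma horizon_cost_measurable [measurable]:
  "f \<in> decision_rules \<Longrightarrow> horizon_cost \<beta> f N \<in> borel_measurable (state_space I)"
  unfolding horizon_cost_def[abs_def]
  by (intro borel_measurable_sum borel_measurable_times_ennreal borel_measurable_const
      stage_mean_measurable stage_cost_rule_measurable)

lemma demand_mean_add:
  assumes "g \<in> borel_measurable (state_space I)" "g' \<in> borel_measurable (state_space I)" "x \<in> X"
  shows "demand_mean (\<lambda>y. g y + g' y) x = demand_mean g x + demand_mean g' x"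
  unfolding demand_mean_def
  using measurable_compose[OF subtract_demand_measurable assms(1)]
    measurable_compose[OF subtract_demand_measurable assms(2)] assms(3)
  by (intro nn_integral_add) auto

lemma demand_mean_cmult:
  assumes "g \<in> borel_measurable (state_space I)" "x \<in> X"
  shows "demand_mean (\<lambda>y. b * g y) x = b * demand_mean g x"
  unfolding demand_mean_def
  using measurable_compose[OF subtract_demand_measurable assms(1)] assms(2)
  by (intro nn_integral_cmult) auto

lemma demand_mean_sum:
  assumes "\<And>i. g i \<in> borel_measurable (state_space I)" "x \<in> X"
  shows "demand_mean (\<lambda>y. \<Sum>i\<in>J. g i y) x = (\<Sum>i\<in>J. demand_mean (g i) x)"
  unfolding demand_mean_def
  using measurable_compose[OF subtract_demand_measurable assms(1)] assms(2)
  by (intro nn_integral_sum) auto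

lemma demand_mean_const: "demand_mean (\<lambda>y. b) x = b"
  unfolding demand_mean_def by (simp add: emeasure_space_1)

lemma horizon_cost_Suc:
  assumes f: "f \<in> decision_rules" and x: "x \<in> X" and "0 \<le> \<beta>"
  shows "horizon_cost \<beta> f (Suc N) x =
    ennreal (stage_cost I x (f 0 x)) + ennreal \<beta> * demand_mean (horizon_cost \<beta> (f \<circ> Suc) N) (x + f 0 x)"
proof -
  have z: "x + f 0 x \<in> X" using f x by (rule order_state)
  note f' = decision_rules_Suc[OF f]
  have meas: "(\<lambda>y. stage_mean (f \<circ> Suc) t (\<lambda>y. ennreal (stage_cost I y ((f \<circ> Suc) t y))) y)
     \<in> borel_measurable (state_space I)" for t
    using f' by (intro stage_mean_measurable stage_cost_rule_measurable)
  have "demand_mean (horizon_cost \<beta> (f \<circ> Suc) N) (x + f 0 x) =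
     (\<Sum>t<N. ennreal (\<beta> ^ t) * demand_mean (\<lambda>y. stage_mean (f \<circ> Suc) t (\<lambda>y. ennreal (stage_cost I y ((f \<circ> Suc) t y))) y) (x + f 0 x))"
    unfolding horizon_cost_def[abs_def]
    by (subst demand_mean_sum[OF _ z]) (auto intro!: sum.cong demand_mean_cmult[OF _ z] meas borel_measurable_times_ennreal borel_measurable_const simp del: o_apply)
  then have "ennreal \<beta> * demand_mean (horizon_cost \<beta> (f \<circ> Suc) N) (x + f 0 x) =
     (\<Sum>t<N. ennreal (\<beta> ^ Suc t) * stage_mean f (Suc t) (\<lambda>y. ennreal (stage_cost I y (f (Suc t) y))) x)"
    using \<open>0 \<le> \<beta>\<close> by (simp add: sum_distrib_left ennreal_mult mult.assoc)
  then show ?thesis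
    unfolding horizon_cost_def by (simp add: sum.lessThan_Suc_shift del: sum.lessThan_Suc stage_mean.simps(2) power_Suc)
qed

lemma discounted_cost_series:
  assumes \<pi>: "\<pi> \<in> policies I" and x: "x \<in> X" and b: "0 \<le> \<beta>"
  shows "discounted_cost I \<beta> \<pi> x =
    (\<Sum>t. ennreal (\<beta> ^ t) * (\<integral>\<^sup>+\<omega>. ennreal (stage_cost I (fst (\<omega> t)) (snd (\<omega> t))) \<partial>trajectories I \<pi> x))"
proof -
  have m: "(\<lambda>\<omega>. ennreal (stage_cost I (fst (\<omega> t)) (snd (\<omega> t)))) \<in> borel_measurable (trajectories I \<pi> x)" for t
    by (subst measurable_cong_sets[OF sets_trajectories[OF x \<pi>] refl], rule measurable_compose[OF component_stage])
       (use stage_cost_measurable in auto)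
  have "discounted_cost I \<beta> \<pi> x =
     (\<integral>\<^sup>+\<omega>. (\<Sum>t. ennreal (\<beta> ^ t) * ennreal (stage_cost I (fst (\<omega> t)) (snd (\<omega> t)))) \<partial>trajectories I \<pi> x)"
    unfolding discounted_cost_def using b by (simp add: ennreal_mult')
  also have "\<dots> = (\<Sum>t. \<integral>\<^sup>+\<omega>. ennreal (\<beta> ^ t) * ennreal (stage_cost I (fst (\<omega> t)) (snd (\<omega> t))) \<partial>trajectories I \<pi> x)"
    by (intro nn_integral_suminf borel_measurable_times_ennreal borel_measurable_const m)
  finally show ?thesis by (simp add: nn_integral_cmult m)
qed

lemma average_cost_series:
  assumes \<pi>: "\<pi> \<in> policies I" and x: "x \<in> X"
  shows "average_cost I \<pi> x =
    limsup (\<lambda>N. ennreal (1 / real N) *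
      (\<Sum>t<N. \<integral>\<^sup>+\<omega>. ennreal (stage_cost I (fst (\<omega> t)) (snd (\<omega> t))) \<partial>trajectories I \<pi> x))"
proof -
  have m: "(\<lambda>\<omega>. ennreal (stage_cost I (fst (\<omega> t)) (snd (\<omega> t)))) \<in> borel_measurable (trajectories I \<pi> x)" for t
    by (subst measurable_cong_sets[OF sets_trajectories[OF x \<pi>] refl], rule measurable_compose[OF component_stage])
       (use stage_cost_measurable in auto)
  show ?thesis unfolding average_cost_def by (subst nn_integral_sum) (auto simp: m)
qed

lemma markov_stage_cost:
  assumes "f \<in> decision_rules" "x \<in> X"
  shows "(\<integral>\<^sup>+\<omega>. ennreal (stage_cost I (fst (\<omega> t)) (snd (\<omega> t))) \<partial>trajectories I (markov_policy f) x)
    = stage_mean f t (\<lambda>y. ennreal (stage_cost I y (f t y))) x"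
  using nn_integral_trajectories[OF assms, of "\<lambda>p. ennreal (stage_cost I (fst p) (snd p))" t] by simp

lemma markov_discounted_cost:
  assumes "f \<in> decision_rules" "x \<in> X" "0 \<le> \<beta>"
  shows "discounted_cost I \<beta> (markov_policy f) x = (SUP N. horizon_cost \<beta> f N x)"
  unfolding discounted_cost_series[OF markov_policies[OF assms(1)] assms(2,3)] horizon_cost_def
  by (simp add: markov_stage_cost assms suminf_eq_SUP)

lemma markov_average_cost:
  assumes "f \<in> decision_rules" "x \<in> X"
  shows "average_cost I (markov_policy f) x = limsup (\<lambda>N. ennreal (1 / real N) * horizon_cost 1 f N x)"
  unfolding average_cost_series[OF markov_policies[OF assms(1)] assms(2)] horizon_cost_def
  by (simp add: markov_stage_cost assms)

lemma markov_discounted_cost_measurable: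
  assumes "f \<in> decision_rules" "0 \<le> \<beta>"
  shows "discounted_cost I \<beta> (markov_policy f) \<in> borel_measurable (state_space I)"
  by (subst measurable_cong[OF markov_discounted_cost]) (use assms in auto)

text \<open>The evaluation equation: the finite-horizon recursion passes to the supremum by monotone
  convergence, and thus holds before any cost is known to be finite.\<close>

lemma markov_discounted_cost_rec:
  assumes f: "f \<in> decision_rules" and x: "x \<in> X" and b: "0 \<le> \<beta>"
  shows "discounted_cost I \<beta> (markov_policy f) x = ennreal (stage_cost I x (f 0 x)) +
     ennreal \<beta> * demand_mean (discounted_cost I \<beta> (markov_policy (f \<circ> Suc))) (x + f 0 x)"
proof -
  let ?h = "\<lambda>N. horizon_cost \<beta> (f \<circ> Suc) N"
  have z: "x + f 0 x \<in> X" using f x by (rule order_state)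
  note f' = decision_rules_Suc[OF f]
  have inc: "incseq (\<lambda>N. horizon_cost \<beta> g N y)" for g y
    unfolding horizon_cost_def by (intro incseq_SucI) simp
  have "discounted_cost I \<beta> (markov_policy f) x = (SUP N. horizon_cost \<beta> f (Suc N) x)"
    unfolding markov_discounted_cost[OF f x b] using inc[of f x]
    by (intro LIMSEQ_unique[OF LIMSEQ_Suc[OF LIMSEQ_SUP] LIMSEQ_SUP]) (auto simp: incseq_def)
  also have "\<dots> = (SUP N. ennreal (stage_cost I x (f 0 x)) + ennreal \<beta> * demand_mean (?h N) (x + f 0 x))"
    by (simp add: horizon_cost_Suc[OF f x b])
  also have "\<dots> = ennreal (stage_cost I x (f 0 x)) + ennreal \<beta> * (SUP N. demand_mean (?h N) (x + f 0 x))"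
    by (simp add: SUP_mult_left_ennreal ennreal_SUP_add_right)
  also have "(SUP N. demand_mean (?h N) (x + f 0 x)) = demand_mean (\<lambda>y. SUP N. ?h N y) (x + f 0 x)"
    unfolding demand_mean_def
    by (rule nn_integral_monotone_convergence_SUP[symmetric])
       (use inc measurable_compose[OF subtract_demand_measurable[OF _ z] horizon_cost_measurable[OF f']]
         in \<open>auto simp: incseq_def le_fun_def\<close>)
  also have "\<dots> = demand_mean (discounted_cost I \<beta> (markov_policy (f \<circ> Suc))) (x + f 0 x)"
    by (rule demand_mean_cong[OF _ z]) (simp add: markov_discounted_cost f' b)
  finally show ?thesis .
qed

text \<open>Induction from horizon zero, whose cost 0 lies below every \<open>W\<close>. Extended
  values allow \<open>W\<close> to be infinite on states where no estimate is wanted.\<close>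

lemma horizon_cost_supersolution:
  assumes f: "f \<in> decision_rules" and stat: "f \<circ> Suc = f" and b: "0 \<le> \<beta>" "x \<in> X"
    and W: "\<And>x. x \<in> X \<Longrightarrow> ennreal (stage_cost I x (f 0 x)) + ennreal \<beta> * demand_mean W (x + f 0 x) \<le> W x"
  shows "horizon_cost \<beta> f N x \<le> W x"
  using \<open>x \<in> X\<close>
proof (induction N arbitrary: x)
  case 0
  then show ?case by (simp add: horizon_cost_def)
next
  case (Suc N)
  have z: "x + f 0 x \<in> X" using f Suc.prems by (rule order_state)
  have "horizon_cost \<beta> f (Suc N) x \<le> ennreal (stage_cost I x (f 0 x)) + ennreal \<beta> * demand_mean W (x + f 0 x)"
    unfolding horizon_cost_Suc[OF f \<open>x \<in> X\<close> b(1)] stat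
    by (intro add_left_mono mult_left_mono demand_mean_mono Suc z) auto
  also have "\<dots> \<le> W x" using W Suc by blast
  finally show ?case .
qed

end

subsection \<open>Discounted values of optimal threshold policies\<close>

context inventory_model
begin

lemma sS_decision_rules:
  assumes "s \<in> X" "S \<in> X" "s \<le> S"
  shows "(\<lambda>_. sS_action s S) \<in> decision_rules"
proof -
  have "sS_action s S x \<in> A" if "x \<in> X" for x
    using assms that by (auto simp: sS_action_def action_iff)
  moreover have "sS_action s S \<in> borel_measurable (state_space I)"
    unfolding sS_action_def by (rule borel_measurable_state_space) measurable
  ultimately show ?thesis
    unfolding decision_rules_def by (auto intro!: measurable_action_spaceI)
qed

lemma sS_policy_eq: "sS_policy I s S = markov_policy (\<lambda>_. sS_action s S)"
  by (simp add: sS_policy_def markov_policy_def)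

section \<open>Cost data and a first upper bound on values\<close>

lemma mean_demand_nonneg: "mean_demand I \<ge> 0"
  unfolding mean_demand_def by (intro integral_nonneg_AE AE_I2 demand_nonneg) auto

lemma D_nonneg: "\<omega> \<in> space (demand_space I) \<Longrightarrow> D \<omega> \<ge> 0"
  by (rule demand_nonneg) auto

lemma L_nonneg: "x \<in> X \<Longrightarrow> L x \<ge> 0"
  by (rule holding_nonneg)

lemma L_coercive: obtains b where "b \<ge> 0" "\<And>x. x \<in> X \<Longrightarrow> L x \<le> C \<Longrightarrow> \<bar>x\<bar> \<le> b"
proof -
  have "eventually (\<lambda>x. L x > C) (inf at_infinity (principal X))"
    using holding_coercive by (simp add: filterlim_at_top_dense)
  then obtain b where b: "\<And>x. norm x \<ge> b \<Longrightarrow> x \<in> X \<Longrightarrow> L x > C"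
    unfolding eventually_inf_principal eventually_at_infinity by blast
  show ?thesis
  proof (rule that[of "max b 0"])
    fix x assume "x \<in> X" "L x \<le> C"
    then show "\<bar>x\<bar> \<le> max b 0" using b[of x] by force
  qed simp
qed

lemma L_bounded: obtains M where "M \<ge> 0" "\<And>x. x \<in> X \<Longrightarrow> l \<le> x \<Longrightarrow> x \<le> h \<Longrightarrow> L x \<le> M"
proof -
  have "compact (L ` (X \<inter> {l..h}))"
    using closed_states holding_continuous
    by (intro compact_continuous_image) (auto intro: continuous_on_subset simp: closed_Int_compact)
  then obtain M where "\<forall>x\<in>L ` (X \<inter> {l..h}). norm x \<le> M"
    by (meson bounded_iff compact_imp_bounded)
  then show ?thesis
    by (intro that[of "max M 0"]) (force simp: le_max_iff_disj)+
qed

text \<open>Up to a constant, the function in the limit condition at minus infinity is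
  \<open>L x + (1 - \<beta>) * c * x\<close>, the expression that bounding \<open>s\<close> from
  below leads to.\<close>

lemma discounted_holding_mean:
  assumes "x \<in> X"
  shows "mean_after_demand I (discounted_holding I \<beta>) x = L x + (1 - \<beta>) * c * x + \<beta> * c * mean_demand I"
proof -
  have 1: "integrable (demand_space I) (\<lambda>\<omega>. (1 - \<beta>) * c * (x - D \<omega>))"
    using demand_integrable by auto
  have "mean_after_demand I (discounted_holding I \<beta>) x =
     L x + (\<integral>\<omega>. (1 - \<beta>) * c * (x - D \<omega>) \<partial>demand_space I) + c * mean_demand I"
    unfolding mean_after_demand_def discounted_holding_def
    using 1 holding_integrable[OF assms] by (simp add: prob_space)
  also have "(\<integral>\<omega>. (1 - \<beta>) * c * (x - D \<omega>) \<partial>demand_space I) = (1 - \<beta>) * c * (x - mean_demand I)"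
    using demand_integrable by (simp add: mean_demand_def prob_space)
  finally show ?thesis by (simp add: algebra_simps)
qed

text \<open>The policy is to order up to 0 in every period. After the first stage an order only
  replaces the previous demand, so a stage costs at most \<open>K + M + c * mean_demand I\<close> in
  the mean, plus \<open>c * max 0 (- x)\<close> once for the initial backlog.\<close>

lemma discounted_value_upper:
  assumes \<beta>: "0 \<le> \<beta>" "\<beta> < 1" and x0: "0 \<le> x\<^sub>0" and M: "\<And>y. y \<in> X \<Longrightarrow> 0 \<le> y \<Longrightarrow> y \<le> x\<^sub>0 \<Longrightarrow> L y \<le> M"
    and x: "x \<in> X" "x \<le> x\<^sub>0"
  shows "discounted_value I \<beta> x \<le> ennreal ((K + M + c * mean_demand I) / (1 - \<beta>) + c * max 0 (- x))"
proof -
  define B where "B = (K + M + c * mean_demand I) / (1 - \<beta>)"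
  \<comment> \<open>The policy never leads above \<open>x\<^sub>0\<close>, since
    \<open>x\<^sub>0\<close> is nonnegative. Above it \<open>M\<close> says nothing about
    \<open>L\<close>, and the infinite value makes the supersolution property trivial.\<close>
  define W where "W x = (if x \<le> x\<^sub>0 then ennreal (B + c * max 0 (- x)) else \<top>)" for x
  let ?f = "\<lambda>_::nat. sS_action 0 0"
  have f: "?f \<in> decision_rules" by (rule sS_decision_rules) auto
  have M0: "M \<ge> 0" using M[of 0] L_nonneg[of 0] x0 by simp
  have B: "B \<ge> 0" unfolding B_def using \<beta> M0 order_cost_pos unit_cost_pos mean_demand_nonneg by simp
  have B_eq: "K + M + c * mean_demand I + \<beta> * B = B"
    unfolding B_def using \<beta> by (simp add: field_simps)
  have super: "ennreal (stage_cost I y (sS_action 0 0 y)) + ennreal \<beta> * demand_mean W (y + sS_action 0 0 y) \<le> W y"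
    if y: "y \<in> X" for y
  proof (cases "y \<le> x\<^sub>0")
    case True
    have z: "y + sS_action 0 0 y = max y 0" by (simp add: sS_action_def)
    have zX: "max y 0 \<in> X" using y by (simp add: max_def)
    have "demand_mean W (max y 0) \<le> demand_mean (\<lambda>z. ennreal (B + c * (max y 0 - z))) (max y 0)"
    proof (rule demand_mean_mono[OF _ zX])
      fix z assume "z \<in> X" "z \<le> max y 0"
      then show "W z \<le> ennreal (B + c * (max y 0 - z))"
        unfolding W_def using True x0 unit_cost_pos by (auto intro!: ennreal_leI mult_left_mono)
    qed
    also have "\<dots> = ennreal (\<integral>\<omega>. B + c * D \<omega> \<partial>demand_space I)"
      unfolding demand_mean_def using demand_integrable B unit_cost_pos
      by (subst nn_integral_eq_integral[symmetric]) (auto intro!: AE_I2 add_nonneg_nonneg simp: D_nonneg)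
    also have "(\<integral>\<omega>. B + c * D \<omega> \<partial>demand_space I) = B + c * mean_demand I"
      using demand_integrable by (simp add: mean_demand_def prob_space)
    finally have dm: "demand_mean W (max y 0) \<le> ennreal (B + c * mean_demand I)" .
    have sc: "stage_cost I y (sS_action 0 0 y) \<le> K + c * max 0 (- y) + M"
      unfolding stage_cost_def z using M[OF zX] True x0 order_cost_pos by (auto simp: sS_action_def)
    have "ennreal (stage_cost I y (sS_action 0 0 y)) + ennreal \<beta> * demand_mean W (y + sS_action 0 0 y)
      \<le> ennreal (K + c * max 0 (- y) + M) + ennreal \<beta> * ennreal (B + c * mean_demand I)"
      unfolding z by (intro add_mono ennreal_leI sc mult_left_mono dm) simp
    also have "\<dots> = ennreal (K + c * max 0 (- y) + M + \<beta> * (B + c * mean_demand I))"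
      using \<beta> B M0 order_cost_pos unit_cost_pos mean_demand_nonneg
      by (subst ennreal_mult[symmetric]) (auto simp: ennreal_plus[symmetric] simp del: ennreal_plus)
    also have "\<dots> \<le> ennreal (B + c * max 0 (- y))"
    proof (rule ennreal_leI)
      have "\<beta> * (c * mean_demand I) \<le> 1 * (c * mean_demand I)"
        using \<beta> unit_cost_pos mean_demand_nonneg by (intro mult_right_mono) auto
      then show "K + c * max 0 (- y) + M + \<beta> * (B + c * mean_demand I) \<le> B + c * max 0 (- y)"
        using B_eq by (simp add: algebra_simps)
    qed
    finally show ?thesis using True by (simp add: W_def)
  qed (simp add: W_def)
  have "discounted_value I \<beta> x \<le> discounted_cost I \<beta> (markov_policy ?f) x"
    unfolding discounted_value_def by (intro INF_lower markov_policies f)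
  also have "\<dots> \<le> W x"
    unfolding markov_discounted_cost[OF f x(1) \<beta>(1)]
    by (intro SUP_least horizon_cost_supersolution[OF f _ \<beta>(1) x(1) super]) auto
  finally show ?thesis using x by (simp add: W_def B_def)
qed

definition optimal_threshold :: "real \<Rightarrow> real \<Rightarrow> real \<Rightarrow> bool" where
  "optimal_threshold \<beta> s S \<longleftrightarrow> 0 \<le> \<beta> \<and> \<beta> < 1 \<and> s \<in> X \<and> S \<in> X \<and> s \<le> S \<and>
     discounted_optimal I \<beta> (sS_policy I s S)"

text \<open>Real values permit subtraction. By \<open>discounted_value_finite\<close> the conversion
  loses nothing for discount factors in \<open>[0, 1)\<close> and states in
  \<open>X\<close>.\<close>

definition opt_value :: "real \<Rightarrow> real \<Rightarrow> real" where
  "opt_value \<beta> x = enn2real (discounted_value I \<beta> x)"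

definition least_value :: "real \<Rightarrow> real" where
  "least_value \<beta> = enn2real (min_value I \<beta>)"

definition value_mean :: "real \<Rightarrow> real \<Rightarrow> real" where
  "value_mean \<beta> x = (\<integral>\<omega>. opt_value \<beta> (x - D \<omega>) \<partial>demand_space I)"

lemma value_nonneg: "opt_value \<beta> x \<ge> 0"
  by (simp add: opt_value_def)

lemma least_value_nonneg: "least_value \<beta> \<ge> 0"
  by (simp add: least_value_def)

lemma discounted_value_finite:
  assumes "0 \<le> \<beta>" "\<beta> < 1" "x \<in> X"
  shows "discounted_value I \<beta> x = ennreal (opt_value \<beta> x)"
proof -
  obtain M where M: "\<And>y. y \<in> X \<Longrightarrow> 0 \<le> y \<Longrightarrow> y \<le> max x 0 \<Longrightarrow> L y \<le> M"
    by (rule L_bounded[of 0 "max x 0"]) blast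
  from discounted_value_upper[of \<beta> "max x 0" M x, OF assms(1,2) _ M assms(3)]
  have "discounted_value I \<beta> x < \<top>" by (auto intro: le_less_trans)
  then show ?thesis by (simp add: opt_value_def)
qed

lemma value_upper:
  assumes \<beta>: "0 \<le> \<beta>" "\<beta> < 1" and x0: "0 \<le> x\<^sub>0" and M: "\<And>y. y \<in> X \<Longrightarrow> 0 \<le> y \<Longrightarrow> y \<le> x\<^sub>0 \<Longrightarrow> L y \<le> M"
    and x: "x \<in> X" "x \<le> x\<^sub>0"
  shows "opt_value \<beta> x \<le> (K + M + c * mean_demand I) / (1 - \<beta>) + c * max 0 (- x)"
proof -
  have "M \<ge> 0" using M[of 0] L_nonneg[of 0] x0 by simp
  then have "(K + M + c * mean_demand I) / (1 - \<beta>) + c * max 0 (- x) \<ge> 0"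
    using \<beta> order_cost_pos unit_cost_pos mean_demand_nonneg by simp
  then show ?thesis
    using discounted_value_upper[OF assms] discounted_value_finite[OF \<beta> x(1)] by simp
qed

lemma min_value_finite:
  assumes "0 \<le> \<beta>" "\<beta> < 1"
  shows "min_value I \<beta> = ennreal (least_value \<beta>)"
proof -
  have "min_value I \<beta> \<le> discounted_value I \<beta> 0"
    unfolding min_value_def by (rule INF_lower) simp
  also have "\<dots> < \<top>" by (simp add: discounted_value_finite[OF assms])
  finally show ?thesis by (simp add: least_value_def)
qed

lemma least_value_le: "0 \<le> \<beta> \<Longrightarrow> \<beta> < 1 \<Longrightarrow> x \<in> X \<Longrightarrow> least_value \<beta> \<le> opt_value \<beta> x"
proof -
  assume *: "0 \<le> \<beta>" "\<beta> < 1" "x \<in> X"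
  then have "min_value I \<beta> \<le> discounted_value I \<beta> x"
    unfolding min_value_def by (intro INF_lower)
  then show ?thesis
    using * value_nonneg by (simp add: min_value_finite discounted_value_finite)
qed

text \<open>Attainment of the infimum is not established; near minimizers with error 1 are enough
  later on.\<close>

lemma least_value_approx:
  assumes "0 \<le> \<beta>" "\<beta> < 1" "\<epsilon> > 0"
  obtains x where "x \<in> X" "opt_value \<beta> x < least_value \<beta> + \<epsilon>"
proof -
  have "min_value I \<beta> < ennreal (least_value \<beta> + \<epsilon>)"
    using assms least_value_nonneg[of \<beta>] by (simp add: min_value_finite ennreal_lessI)
  then obtain x where "x \<in> X" "discounted_value I \<beta> x < ennreal (least_value \<beta> + \<epsilon>)"
    unfolding min_value_def by (auto simp: INF_less_iff)
  then show ?thesis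
    using that assms value_nonneg by (simp add: discounted_value_finite ennreal_less_iff)
qed

lemma relative_value_eq:
  "0 \<le> \<beta> \<Longrightarrow> \<beta> < 1 \<Longrightarrow> x \<in> X \<Longrightarrow> relative_value I \<beta> x = ennreal (opt_value \<beta> x - least_value \<beta>)"
  by (simp add: relative_value_def discounted_value_finite min_value_finite ennreal_minus least_value_nonneg)

text \<open>Start in state 0 and order up to 0 forever. The bound is free of \<open>\<beta>\<close>,
  which makes all later constants uniform.\<close>

lemma scaled_least_value_le:
  assumes "0 \<le> \<beta>" "\<beta> < 1"
  shows "(1 - \<beta>) * least_value \<beta> \<le> K + L 0 + c * mean_demand I"
proof -
  have "least_value \<beta> \<le> opt_value \<beta> 0" using assms by (simp add: least_value_le)
  also have "\<dots> \<le> (K + L 0 + c * mean_demand I) / (1 - \<beta>)"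
    using value_upper[OF assms, of 0 "L 0" 0] by simp
  finally show ?thesis using assms by (simp add: field_simps)
qed

lemma optimal_thresholdD:
  assumes "optimal_threshold \<beta> s S"
  shows "0 \<le> \<beta>" "\<beta> < 1" "s \<in> X" "S \<in> X" "s \<le> S"
    "\<And>x. x \<in> X \<Longrightarrow> discounted_cost I \<beta> (markov_policy (\<lambda>_. sS_action s S)) x = ennreal (opt_value \<beta> x)"
  using assms unfolding optimal_threshold_def discounted_optimal_def sS_policy_eq
  by (auto simp: discounted_value_finite)

text \<open>An infimum over uncountably many policies need not be measurable; the cost of the
  optimal threshold policy is, as a countable supremum of horizon costs.\<close>

lemma value_measurable:
  assumes "optimal_threshold \<beta> s S"
  shows "opt_value \<beta> \<in> borel_measurable (state_space I)"
proof -
  note o = optimal_thresholdD[OF assms]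
  have "(\<lambda>x. enn2real (discounted_cost I \<beta> (markov_policy (\<lambda>_. sS_action s S)) x)) \<in> borel_measurable (state_space I)"
    by (rule borel_measurable_enn2real[OF markov_discounted_cost_measurable])
       (use o sS_decision_rules in auto)
  then show ?thesis
    by (rule measurable_cong[THEN iffD1, rotated]) (simp add: o(6) value_nonneg)
qed

text \<open>Below a fixed level the value grows at most linearly as the state falls, and the demand
  has a finite mean.\<close>

lemma value_integrable:
  assumes opt: "optimal_threshold \<beta> s S" and x: "x \<in> X"
  shows "integrable (demand_space I) (\<lambda>\<omega>. opt_value \<beta> (x - D \<omega>))"
proof -
  note o = optimal_thresholdD[OF opt]
  obtain M where M: "\<And>y. y \<in> X \<Longrightarrow> 0 \<le> y \<Longrightarrow> y \<le> max x 0 \<Longrightarrow> L y \<le> M"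
    by (rule L_bounded[of 0 "max x 0"]) blast
  have "integrable (demand_space I) (\<lambda>\<omega>. (K + M + c * mean_demand I) / (1 - \<beta>) + c * (\<bar>x\<bar> + D \<omega>))"
    using demand_integrable by auto
  then show ?thesis
  proof (rule Bochner_Integration.integrable_bound)
    show "(\<lambda>\<omega>. opt_value \<beta> (x - D \<omega>)) \<in> borel_measurable (demand_space I)"
      by (rule measurable_compose[OF subtract_demand_measurable value_measurable[OF opt]]) (use x in auto)
    show "AE \<omega> in demand_space I. norm (opt_value \<beta> (x - D \<omega>)) \<le>
       norm ((K + M + c * mean_demand I) / (1 - \<beta>) + c * (\<bar>x\<bar> + D \<omega>))"
    proof (rule AE_I2)
      fix \<omega> assume \<omega>: "\<omega> \<in> space (demand_space I)"
      have "opt_value \<beta> (x - D \<omega>) \<le> (K + M + c * mean_demand I) / (1 - \<beta>) + c * max 0 (- (x - D \<omega>))"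
        using M state_diff[OF x _ \<omega>, of 1] D_nonneg[OF \<omega>] by (intro value_upper[OF o(1,2), of "max x 0"]) auto
      also have "\<dots> \<le> (K + M + c * mean_demand I) / (1 - \<beta>) + c * (\<bar>x\<bar> + D \<omega>)"
        using unit_cost_pos D_nonneg[OF \<omega>] by (intro add_left_mono mult_left_mono) auto
      finally show "norm (opt_value \<beta> (x - D \<omega>)) \<le> norm ((K + M + c * mean_demand I) / (1 - \<beta>) + c * (\<bar>x\<bar> + D \<omega>))"
        using value_nonneg[of \<beta> "x - D \<omega>"] by simp
    qed
  qed
qed

lemma demand_mean_value:
  assumes opt: "optimal_threshold \<beta> s S" and x: "x \<in> X"
  shows "demand_mean (\<lambda>y. ennreal (opt_value \<beta> y)) x = ennreal (value_mean \<beta> x)"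
  unfolding demand_mean_def value_mean_def
  by (rule nn_integral_eq_integral[OF value_integrable[OF assms]]) (simp add: value_nonneg)

lemma value_mean_nonneg: "value_mean \<beta> x \<ge> 0"
  unfolding value_mean_def by (intro integral_nonneg_AE AE_I2 value_nonneg)

text \<open>Take action \<open>a\<close> once and follow the optimal threshold policy afterwards.
  This is a Markov policy, hence no cheaper than the value.\<close>

lemma value_le_action:
  assumes opt: "optimal_threshold \<beta> s S" and x: "x \<in> X" and a: "a \<in> A"
  shows "opt_value \<beta> x \<le> stage_cost I x a + \<beta> * value_mean \<beta> (x + a)"
proof -
  note o = optimal_thresholdD[OF opt]
  define f where "f = (\<lambda>t::nat. if t = 0 then (\<lambda>_. a) else sS_action s S)"
  have f: "f \<in> decision_rules"
    unfolding decision_rules_def f_def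
    using decision_rule_measurable[OF sS_decision_rules[OF o(3-5)]] a by auto
  have fS: "f \<circ> Suc = (\<lambda>_. sS_action s S)" by (auto simp: f_def)
  have z: "x + a \<in> X" using x a by (rule state_add)
  have "ennreal (opt_value \<beta> x) \<le> discounted_cost I \<beta> (markov_policy f) x"
    unfolding discounted_value_finite[OF o(1,2) x, symmetric] discounted_value_def
    by (intro INF_lower markov_policies f)
  also have "\<dots> = ennreal (stage_cost I x a) + ennreal \<beta> *
      demand_mean (discounted_cost I \<beta> (markov_policy (\<lambda>_. sS_action s S))) (x + a)"
    unfolding markov_discounted_cost_rec[OF f x o(1)] fS by (simp add: f_def)
  also have "demand_mean (discounted_cost I \<beta> (markov_policy (\<lambda>_. sS_action s S))) (x + a) = ennreal (value_mean \<beta> (x + a))"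
    unfolding demand_mean_value[OF opt z, symmetric] by (rule demand_mean_cong[OF o(6) z])
  also have "ennreal (stage_cost I x a) + ennreal \<beta> * \<dots> = ennreal (stage_cost I x a + \<beta> * value_mean \<beta> (x + a))"
    using o stage_cost_nonneg[OF x a] value_mean_nonneg by (simp add: ennreal_mult)
  finally show ?thesis
    using o stage_cost_nonneg[OF x a] value_mean_nonneg by (simp add: ennreal_le_iff del: ennreal_plus)
qed

lemma value_threshold:
  assumes opt: "optimal_threshold \<beta> s S" and x: "x \<in> X"
  shows "opt_value \<beta> x = stage_cost I x (sS_action s S x) + \<beta> * value_mean \<beta> (x + sS_action s S x)"
proof -
  note o = optimal_thresholdD[OF opt]
  let ?f = "\<lambda>_::nat. sS_action s S"
  have f: "?f \<in> decision_rules" by (rule sS_decision_rules[OF o(3-5)])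
  have a: "sS_action s S x \<in> A" using decision_rule_action[OF f x] .
  have z: "x + sS_action s S x \<in> X" using x a by (rule state_add)
  have fS: "?f \<circ> Suc = ?f" by auto
  have "ennreal (opt_value \<beta> x) = ennreal (stage_cost I x (sS_action s S x)) + ennreal \<beta> *
      demand_mean (discounted_cost I \<beta> (markov_policy ?f)) (x + sS_action s S x)"
    unfolding o(6)[OF x, symmetric] by (subst markov_discounted_cost_rec[OF f x o(1)]) (simp add: fS)
  also have "demand_mean (discounted_cost I \<beta> (markov_policy ?f)) (x + sS_action s S x) = ennreal (value_mean \<beta> (x + sS_action s S x))"
    unfolding demand_mean_value[OF opt z, symmetric] by (rule demand_mean_cong[OF o(6) z])
  also have "ennreal (stage_cost I x (sS_action s S x)) + ennreal \<beta> * \<dots> =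
     ennreal (stage_cost I x (sS_action s S x) + \<beta> * value_mean \<beta> (x + sS_action s S x))"
    using o stage_cost_nonneg[OF x a] value_mean_nonneg by (simp add: ennreal_mult)
  finally show ?thesis
    using o stage_cost_nonneg[OF x a] value_mean_nonneg value_nonneg
    by (subst (asm) ennreal_inj) auto
qed

lemma value_no_order:
  assumes opt: "optimal_threshold \<beta> s S" and x: "x \<in> X" "s \<le> x"
  shows "opt_value \<beta> x = L x + \<beta> * value_mean \<beta> x"
  using value_threshold[OF opt x(1)] x by (simp add: sS_action_def stage_cost_def)

lemma value_order:
  assumes opt: "optimal_threshold \<beta> s S" and x: "x \<in> X" "x < s"
  shows "opt_value \<beta> x = K + c * (S - x) + opt_value \<beta> S"
  using value_threshold[OF opt x(1)] x optimal_thresholdD[OF opt] value_no_order[OF opt, of S]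
  by (simp add: sS_action_def stage_cost_def)

text \<open>From \<open>y\<close>, which is not below \<open>s\<close>, the optimal policy does not
  order. So after ordering up to \<open>y\<close> the remaining cost, holding included, is exactly
  the value at \<open>y\<close>.\<close>

lemma value_le_order:
  assumes opt: "optimal_threshold \<beta> s S" and x: "x \<in> X" "y \<in> X" "x \<le> y" "s \<le> y"
  shows "opt_value \<beta> x \<le> K + c * (y - x) + opt_value \<beta> y"
proof (cases "x = y")
  case False
  then show ?thesis
    using value_le_action[OF opt x(1), of "y - x"] value_no_order[OF opt x(2,4)] x
    by (simp add: action_iff stage_cost_def)
qed (use order_cost_pos in simp)

text \<open>Below \<open>s\<close> the optimal policy orders up to \<open>S\<close>. From
  \<open>s\<close> the same level can be reached at the same fixed cost with \<open>s - x\<close>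
  fewer units.\<close>

lemma value_below_threshold:
  assumes opt: "optimal_threshold \<beta> s S" and x: "x \<in> X" "x \<le> s"
  shows "opt_value \<beta> s + c * (s - x) \<le> opt_value \<beta> x"
proof (cases "x = s")
  case False
  then show ?thesis
    using value_order[OF opt, of x] value_le_order[OF opt, of s S] x optimal_thresholdD[OF opt]
    by (simp add: algebra_simps)
qed simp

section \<open>Bounds on near minimizers and thresholds, uniform in the discount factor\<close>

lemma value_mean_ge:
  assumes opt: "optimal_threshold \<beta> s S" and x: "x \<in> X"
    and g: "integrable (demand_space I) g" "\<And>\<omega>. \<omega> \<in> space (demand_space I) \<Longrightarrow> g \<omega> \<le> opt_value \<beta> (x - D \<omega>)"
  shows "(\<integral>\<omega>. g \<omega> \<partial>demand_space I) \<le> value_mean \<beta> x"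
  unfolding value_mean_def by (intro integral_mono g value_integrable[OF opt x])

lemma least_value_le_value_mean:
  assumes opt: "optimal_threshold \<beta> s S" and x: "x \<in> X"
  shows "least_value \<beta> \<le> value_mean \<beta> x"
  using value_mean_ge[OF assms, of "\<lambda>_. least_value \<beta>"] state_diff[OF x, of 1]
    least_value_le[OF optimal_thresholdD(1,2)[OF opt]] by (simp add: prob_space)

text \<open>Lifting a near minimizer to at least \<open>s\<close> does not increase its value. There
  nothing is ordered, so \<open>L y\<close> is at most the value minus \<open>\<beta>\<close> times
  the least value, hence at most \<open>(1 - \<beta>) * least_value \<beta> + 1\<close>, and
  coercivity applies. The property \<open>s \<le> y\<close> makes \<open>y\<close> a target for
  \<open>value_le_order\<close>.\<close>

lemma near_minimizer:
  obtains b where "b \<ge> 0"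
    "\<And>\<beta> s S. optimal_threshold \<beta> s S \<Longrightarrow>
       \<exists>y\<in>X. s \<le> y \<and> \<bar>y\<bar> \<le> b \<and> opt_value \<beta> y \<le> least_value \<beta> + 1"
proof -
  obtain b where b: "b \<ge> 0" "\<And>x. x \<in> X \<Longrightarrow> L x \<le> K + L 0 + c * mean_demand I + 1 \<Longrightarrow> \<bar>x\<bar> \<le> b"
    by (rule L_coercive) blast
  show ?thesis
  proof (rule that[OF b(1)])
    fix \<beta> s S assume opt: "optimal_threshold \<beta> s S"
    note o = optimal_thresholdD[OF opt]
    obtain x where x: "x \<in> X" "opt_value \<beta> x < least_value \<beta> + 1"
      by (rule least_value_approx[OF o(1,2), of 1]) auto
    define y where "y = max x s"
    have y: "y \<in> X" "s \<le> y" using x o by (auto simp: y_def max_def)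
    have vy: "opt_value \<beta> y \<le> least_value \<beta> + 1"
    proof (cases "x \<le> s")
      case True
      then have "c * (s - x) \<ge> 0" using unit_cost_pos by simp
      then show ?thesis using value_below_threshold[OF opt x(1) True] x True by (simp add: y_def max_def)
    qed (use x in \<open>simp add: y_def max_def\<close>)
    have "L y + \<beta> * least_value \<beta> \<le> opt_value \<beta> y"
      using value_no_order[OF opt y] least_value_le_value_mean[OF opt y(1)] o(1)
      by (simp add: mult_left_mono)
    then have "L y \<le> (1 - \<beta>) * least_value \<beta> + 1" using vy by (simp add: algebra_simps)
    also have "\<dots> \<le> K + L 0 + c * mean_demand I + 1" using scaled_least_value_le[OF o(1,2)] by simp
    finally show "\<exists>y\<in>X. s \<le> y \<and> \<bar>y\<bar> \<le> b \<and> opt_value \<beta> y \<le> least_value \<beta> + 1"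
      using b(2)[OF y(1)] y vy by blast
  qed
qed

text \<open>The limit is used at the single factor \<open>\<beta>\<^sub>1\<close>. For
  \<open>\<beta>\<close> at least \<open>\<beta>\<^sub>2\<close> the weight of the linear term is at
  most \<open>1 - \<beta>\<^sub>2\<close>; the remaining gap
  \<open>\<beta>\<^sub>2 - \<beta>\<^sub>1\<close> leaves a linear term that excludes very negative
  \<open>s\<close>.\<close>

lemma thresholds_bounded:
  assumes \<beta>\<^sub>1: "\<beta>\<^sub>1 < 1"
    and lim: "((\<lambda>x. ereal (mean_after_demand I (discounted_holding I \<beta>\<^sub>1) x)) \<longlongrightarrow> l) (inf at_bot (principal X))"
    and l: "l > -\<infinity>"
  obtains \<beta>\<^sub>2 lo hi where "\<beta>\<^sub>2 < 1"
    "\<And>\<beta> s S. \<beta>\<^sub>2 \<le> \<beta> \<Longrightarrow> optimal_threshold \<beta> s S \<Longrightarrow> lo \<le> s \<and> S \<le> hi"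
proof -
  obtain b where b: "b \<ge> 0"
    "\<And>\<beta> s S. optimal_threshold \<beta> s S \<Longrightarrow> \<exists>y\<in>X. s \<le> y \<and> \<bar>y\<bar> \<le> b \<and> opt_value \<beta> y \<le> least_value \<beta> + 1"
    by (rule near_minimizer) blast
  \<comment> \<open>Ordering from \<open>s\<close> up to a near minimizer costs at most
    \<open>K + c * (b - s) + 1\<close> beyond the least value. \<open>C\<close> collects the part of
    this free of \<open>s\<close> and the bound on the scaled least value.\<close>
  define C where "C = K + c * b + 1 + (K + L 0 + c * mean_demand I)"
  define \<beta>\<^sub>2 where "\<beta>\<^sub>2 = (\<beta>\<^sub>1 + 1) / 2"
  have \<beta>\<^sub>2: "\<beta>\<^sub>1 < \<beta>\<^sub>2" "\<beta>\<^sub>2 < 1" using \<beta>\<^sub>1 by (auto simp: \<beta>\<^sub>2_def)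
  obtain g where g: "ereal g < l" using l by (meson ereal_dense2)
  have "eventually (\<lambda>x. ereal g < ereal (mean_after_demand I (discounted_holding I \<beta>\<^sub>1) x)) (inf at_bot (principal X))"
    using order_tendstoD(1)[OF lim g] .
  then obtain x\<^sub>1 where x\<^sub>1: "\<And>x. x \<le> x\<^sub>1 \<Longrightarrow> x \<in> X \<Longrightarrow> g < L x + (1 - \<beta>\<^sub>1) * c * x + \<beta>\<^sub>1 * c * mean_demand I"
    unfolding eventually_inf_principal eventually_at_bot_linorder
    by (auto simp: discounted_holding_mean)
  define g' where "g' = g - \<beta>\<^sub>1 * c * mean_demand I"
  \<comment> \<open>At or below \<open>x\<^sub>1\<close> the lower bound \<open>g\<close> is valid,
    below 0 multiplication by \<open>s\<close> reverses inequalities, and below the last term the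
    linear gap exceeds \<open>C - g'\<close>.\<close>
  define lo where "lo = min (min x\<^sub>1 0) (- (C - g') / ((\<beta>\<^sub>2 - \<beta>\<^sub>1) * c))"
  show ?thesis
  proof (rule that[OF \<beta>\<^sub>2(2), of lo "b + 1 / c"])
    fix \<beta> s S assume "\<beta>\<^sub>2 \<le> \<beta>" and opt: "optimal_threshold \<beta> s S"
    note o = optimal_thresholdD[OF opt]
    obtain y where y: "y \<in> X" "s \<le> y" "\<bar>y\<bar> \<le> b" "opt_value \<beta> y \<le> least_value \<beta> + 1"
      using b(2)[OF opt] by blast
    have cy: "c * y \<le> c * b" using y unit_cost_pos by simp
    have "lo \<le> s"
    proof (rule ccontr)
      assume "\<not> lo \<le> s"
      then have s: "s < x\<^sub>1" "s < 0" "s < - (C - g') / ((\<beta>\<^sub>2 - \<beta>\<^sub>1) * c)" by (auto simp: lo_def)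
      have "opt_value \<beta> s \<le> value_mean \<beta> s"
      proof -
        have "opt_value \<beta> s \<le> opt_value \<beta> (s - D \<omega>)" if "\<omega> \<in> space (demand_space I)" for \<omega>
        proof -
          have "c * D \<omega> \<ge> 0" using unit_cost_pos D_nonneg[OF that] by simp
          then show ?thesis
            using value_below_threshold[OF opt state_diff[OF o(3) _ that, of 1]] D_nonneg[OF that] by simp
        qed
        then show ?thesis
          using value_mean_ge[OF opt o(3), of "\<lambda>_. opt_value \<beta> s"] by (simp add: prob_space)
      qed
      then have "\<beta> * opt_value \<beta> s \<le> \<beta> * value_mean \<beta> s" using o(1) by (rule mult_left_mono)
      then have "L s \<le> (1 - \<beta>) * opt_value \<beta> s"
        using value_no_order[OF opt o(3) order_refl] by (simp add: algebra_simps)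
      also have "\<dots> \<le> (1 - \<beta>) * (K + c * (y - s) + (least_value \<beta> + 1))"
        using value_le_order[OF opt o(3) y(1,2,2)] y(4) o(2) by (intro mult_left_mono) auto
      also have "\<dots> = (1 - \<beta>) * (K + c * y + 1) + (1 - \<beta>) * least_value \<beta> - (1 - \<beta>) * c * s"
        by (simp add: algebra_simps)
      also have "(1 - \<beta>) * (K + c * y + 1) \<le> (1 - \<beta>) * (K + c * b + 1)"
        using cy o(2) by (intro mult_left_mono) auto
      also have "\<dots> \<le> 1 * (K + c * b + 1)"
        using o(1) order_cost_pos unit_cost_pos b(1) by (intro mult_right_mono) auto
      finally have "L s + (1 - \<beta>) * c * s \<le> C"
        using scaled_least_value_le[OF o(1,2)] by (simp add: C_def)
      moreover have "(1 - \<beta>\<^sub>2) * c * s \<le> (1 - \<beta>) * c * s"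
      proof -
        have "(1 - \<beta>) * c \<le> (1 - \<beta>\<^sub>2) * c" using \<open>\<beta>\<^sub>2 \<le> \<beta>\<close> unit_cost_pos by (intro mult_right_mono) auto
        then show ?thesis using s(2) by (intro mult_right_mono_neg[of "(1 - \<beta>) * c"]) auto
      qed
      moreover have "g' < L s + (1 - \<beta>\<^sub>1) * c * s" using x\<^sub>1[OF _ o(3)] s(1) by (simp add: g'_def)
      ultimately have "g' - (\<beta>\<^sub>2 - \<beta>\<^sub>1) * c * s < C" by (simp add: algebra_simps)
      moreover have "s * ((\<beta>\<^sub>2 - \<beta>\<^sub>1) * c) < - (C - g')"
        using s(3) \<beta>\<^sub>2 unit_cost_pos by (subst (asm) pos_less_divide_eq) auto
      ultimately show False by (simp add: algebra_simps)
    qed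
    moreover have "S \<le> b + 1 / c"
    proof -
      \<comment> \<open>Any state strictly below \<open>s\<close> would do: there the optimal policy
        orders up to \<open>S\<close>, and ordering up to \<open>y\<close> instead cannot be
        cheaper. The state itself cancels from the comparison.\<close>
      have x: "s - 1 \<in> X" using o(3) by (cases rule: states_cases) auto
      have "K + c * (S - (s - 1)) + least_value \<beta> \<le> K + c * (y - (s - 1)) + opt_value \<beta> y"
        using value_order[OF opt x] value_le_order[OF opt x y(1) _ y(2)] y(2) least_value_le[OF o(1,2,4)] by simp
      then have "c * S \<le> c * b + 1" using y(4) cy by (simp add: algebra_simps)
      then show ?thesis using unit_cost_pos by (simp add: field_simps)
    qed
    ultimately show "lo \<le> s \<and> S \<le> b + 1 / c" by blast
  qed
qed

section \<open>Bounds on relative values, uniform in the discount factor\<close>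

lemma mean_min_demand_pos: "(\<integral>\<omega>. min (D \<omega>) 1 \<partial>demand_space I) > 0"
proof -
  have int: "integrable (demand_space I) (\<lambda>\<omega>. min (D \<omega>) 1)"
    using demand_integrable by (intro integrable_min) auto
  have "(\<integral>\<omega>. min (D \<omega>) 1 \<partial>demand_space I) \<noteq> 0"
  proof
    assume "(\<integral>\<omega>. min (D \<omega>) 1 \<partial>demand_space I) = 0"
    then have "AE \<omega> in demand_space I. min (D \<omega>) 1 = 0"
      using integral_nonneg_eq_0_iff_AE[OF int] by (auto simp: D_nonneg)
    then have "AE \<omega> in demand_space I. \<not> D \<omega> > 0" by (rule AE_mp) (auto simp: min_def)
    then have "prob {\<omega> \<in> space (demand_space I). D \<omega> > 0} = 0"
      by (subst (asm) AE_iff_measurable[OF _ refl]) (auto simp: measure_def)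
    then show False using demand_pos by simp
  qed
  moreover have "(\<integral>\<omega>. min (D \<omega>) 1 \<partial>demand_space I) \<ge> 0"
    by (intro integral_nonneg_AE AE_I2) (auto simp: D_nonneg)
  ultimately show ?thesis by simp
qed

text \<open>\<open>W\<close> dominates the cost of waiting without orders until the stock is at most
  \<open>- b\<close> and then ordering up to a near minimizer. Waiting ends because demand has a
  positive mean drift. The excess \<open>g\<close> of the relative value over \<open>W\<close>
  contracts by \<open>\<beta>\<close> in each step, so that the crude initial bound
  disappears.\<close>

lemma relative_value_bounded:
  assumes "x\<^sub>1 \<in> X"
  obtains B where "\<And>\<beta> s S. optimal_threshold \<beta> s S \<Longrightarrow> opt_value \<beta> x\<^sub>1 \<le> least_value \<beta> + B"
proof -
  obtain b where b: "b \<ge> 0"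
    "\<And>\<beta> s S. optimal_threshold \<beta> s S \<Longrightarrow> \<exists>y\<in>X. s \<le> y \<and> \<bar>y\<bar> \<le> b \<and> opt_value \<beta> y \<le> least_value \<beta> + 1"
    by (rule near_minimizer) blast
  define x\<^sub>0 where "x\<^sub>0 = max x\<^sub>1 0"
  have x0: "x\<^sub>0 \<ge> 0" "x\<^sub>1 \<le> x\<^sub>0" by (auto simp: x\<^sub>0_def)
  obtain M where M: "M \<ge> 0" "\<And>y. y \<in> X \<Longrightarrow> - b \<le> y \<Longrightarrow> y \<le> x\<^sub>0 \<Longrightarrow> L y \<le> M"
    by (rule L_bounded) blast
  define \<eta> where "\<eta> = (\<integral>\<omega>. min (D \<omega>) 1 \<partial>demand_space I)"
  have \<eta>: "\<eta> > 0" unfolding \<eta>_def by (rule mean_min_demand_pos)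
  (* lam makes one period of waiting lower W by at least M in the mean, as f drops by min D 1. *)
  define lam where "lam = (M + c * mean_demand I) / \<eta>"
  have lam: "lam \<ge> 0" using M \<eta> unit_cost_pos mean_demand_nonneg by (simp add: lam_def)
  \<comment> \<open>\<open>K + c * b + 1 - c * x\<close> covers an order from \<open>x\<close> up to
    a near minimizer in \<open>[- b, b]\<close>; the extra \<open>c * x\<^sub>0\<close> keeps
    \<open>W\<close> nonnegative up to \<open>x\<^sub>0\<close>.\<close>
  define B where "B = K + c * b + 1 + c * x\<^sub>0"
  \<comment> \<open>The shift by 1 gives \<open>f x \<ge> 1\<close> for \<open>x \<ge> - b\<close>,
    so that a demand \<open>d\<close> lowers \<open>f\<close> by at least \<open>min d 1\<close> in
    spite of the cut at zero.\<close>
  define f where "f x = max (x + b + 1) 0" for x :: real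
  define W where "W x = B - c * x + lam * f x" for x
  have f_nonneg: "f x \<ge> 0" for x by (simp add: f_def)
  have W_ge: "K + c * b + 1 + c * (x\<^sub>0 - x) \<le> W x" for x
    using lam f_nonneg[of x] by (simp add: W_def B_def algebra_simps)
  have W_nonneg: "W x \<ge> 0" if "x \<le> x\<^sub>0" for x
  proof -
    have "c * (x\<^sub>0 - x) \<ge> 0" "c * b \<ge> 0" using that b(1) unit_cost_pos by auto
    then show ?thesis using W_ge[of x] order_cost_pos by linarith
  qed
  have intf: "integrable (demand_space I) (\<lambda>\<omega>. f (x - D \<omega>))" for x
    unfolding f_def using demand_integrable by (intro integrable_max) auto
  have intW: "integrable (demand_space I) (\<lambda>\<omega>. W (x - D \<omega>))" for x
    unfolding W_def using demand_integrable intf[of x] by auto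
  have W_super: "M + (\<integral>\<omega>. W (x - D \<omega>) \<partial>demand_space I) \<le> W x" if "- b \<le> x" for x
  proof -
    have "\<eta> \<le> (\<integral>\<omega>. f x - f (x - D \<omega>) \<partial>demand_space I)"
      unfolding \<eta>_def
    proof (rule integral_mono)
      show "min (D \<omega>) 1 \<le> f x - f (x - D \<omega>)" if "\<omega> \<in> space (demand_space I)" for \<omega>
        using D_nonneg[OF that] \<open>- b \<le> x\<close> by (auto simp: f_def)
    qed (use demand_integrable intf[of x] in \<open>auto intro!: integrable_min\<close>)
    also have "\<dots> = f x - (\<integral>\<omega>. f (x - D \<omega>) \<partial>demand_space I)"
      using intf[of x] by (simp add: prob_space)
    finally have "lam * \<eta> \<le> lam * (f x - (\<integral>\<omega>. f (x - D \<omega>) \<partial>demand_space I))"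
      using lam by (rule mult_left_mono)
    moreover have "lam * \<eta> = M + c * mean_demand I" using \<eta> by (simp add: lam_def)
    moreover have "(\<integral>\<omega>. W (x - D \<omega>) \<partial>demand_space I) =
        B - c * (x - mean_demand I) + lam * (\<integral>\<omega>. f (x - D \<omega>) \<partial>demand_space I)"
      unfolding W_def using demand_integrable intf[of x]
      by (simp add: prob_space mean_demand_def algebra_simps)
    ultimately show ?thesis by (simp add: W_def algebra_simps)
  qed
  show ?thesis
  proof (rule that[of "W x\<^sub>1"])
    fix \<beta> s S assume opt: "optimal_threshold \<beta> s S"
    note o = optimal_thresholdD[OF opt]
    obtain y where y: "y \<in> X" "s \<le> y" "\<bar>y\<bar> \<le> b" "opt_value \<beta> y \<le> least_value \<beta> + 1"
      using b(2)[OF opt] by blast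
    define g where "g x = opt_value \<beta> x - least_value \<beta> - W x" for x
    \<comment> \<open>\<open>G\<close> may blow up as \<open>\<beta>\<close> tends to 1. This is
      harmless: for fixed \<open>\<beta>\<close> it is multiplied by \<open>\<beta> ^ n\<close> and
      \<open>n\<close> tends to infinity.\<close>
    define G where "G = (K + M + c * mean_demand I) / (1 - \<beta>) + c * b"
    have G: "G \<ge> 0"
      unfolding G_def using M o b(1) order_cost_pos unit_cost_pos mean_demand_nonneg by simp
    have low: "g x \<le> 0" if "x \<in> X" "x \<le> - b" for x
    proof -
      have "opt_value \<beta> x \<le> K + c * (y - x) + (least_value \<beta> + 1)"
        using value_le_order[OF opt that(1) y(1) _ y(2)] y(3,4) that(2) by linarith
      moreover have "c * y \<le> c * b" using y unit_cost_pos by simp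
      moreover have "c * x\<^sub>0 \<ge> 0" using x0 unit_cost_pos by simp
      ultimately show ?thesis using W_ge[of x] by (simp add: g_def algebra_simps)
    qed
    have "\<forall>x\<in>X. x \<le> x\<^sub>0 \<longrightarrow> g x \<le> \<beta> ^ n * G" for n
    proof (induction n)
      case 0
      show ?case
      proof safe
        fix x assume x: "x \<in> X" "x \<le> x\<^sub>0"
        show "g x \<le> \<beta> ^ 0 * G"
        proof (cases "x \<le> - b")
          case False
          have "opt_value \<beta> x \<le> (K + M + c * mean_demand I) / (1 - \<beta>) + c * max 0 (- x)"
            using x0 b(1) by (intro value_upper[OF o(1,2) x0(1) _ x] M(2)) auto
          also have "\<dots> \<le> G"
            unfolding G_def using False b(1) unit_cost_pos by (intro add_left_mono mult_left_mono) auto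
          finally show ?thesis
            using W_nonneg[OF x(2)] least_value_nonneg[of \<beta>] by (simp add: g_def)
        qed (use low[OF x(1)] G in simp)
      qed
    next
      case (Suc n)
      show ?case
      proof safe
        fix x assume x: "x \<in> X" "x \<le> x\<^sub>0"
        show "g x \<le> \<beta> ^ Suc n * G"
        proof (cases "x \<le> - b")
          case True
          moreover have "\<beta> ^ Suc n * G \<ge> 0" using o(1) G by simp
          ultimately show ?thesis using low[OF x(1)] by linarith
        next
          case False
          have intg: "integrable (demand_space I) (\<lambda>\<omega>. g (x - D \<omega>))"
            unfolding g_def using value_integrable[OF opt x(1)] intW[of x] by auto
          have "opt_value \<beta> x \<le> L x + \<beta> * value_mean \<beta> x"
            using value_le_action[OF opt x(1), of 0] by (simp add: stage_cost_def)
          moreover have "L x \<le> M" using M(2) x False by simp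
          moreover have "M + \<beta> * (\<integral>\<omega>. W (x - D \<omega>) \<partial>demand_space I) \<le> W x"
          proof -
            have "(\<integral>\<omega>. W (x - D \<omega>) \<partial>demand_space I) \<ge> 0"
              using x D_nonneg by (intro integral_nonneg_AE AE_I2 W_nonneg) (force intro: order_trans)
            then have "\<beta> * (\<integral>\<omega>. W (x - D \<omega>) \<partial>demand_space I) \<le> 1 * (\<integral>\<omega>. W (x - D \<omega>) \<partial>demand_space I)"
              using o(2) by (intro mult_right_mono) auto
            then show ?thesis using W_super[of x] False by simp
          qed
          moreover have "\<beta> * least_value \<beta> \<le> 1 * least_value \<beta>"
            using o(2) least_value_nonneg by (intro mult_right_mono) auto
          ultimately have "g x \<le> \<beta> * (value_mean \<beta> x - least_value \<beta> - (\<integral>\<omega>. W (x - D \<omega>) \<partial>demand_space I))"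
            by (simp add: g_def algebra_simps)
          also have "value_mean \<beta> x - least_value \<beta> - (\<integral>\<omega>. W (x - D \<omega>) \<partial>demand_space I) = (\<integral>\<omega>. g (x - D \<omega>) \<partial>demand_space I)"
            unfolding g_def value_mean_def using value_integrable[OF opt x(1)] intW[of x] by (simp add: prob_space)
          also have "\<beta> * \<dots> \<le> \<beta> * (\<integral>\<omega>. \<beta> ^ n * G \<partial>demand_space I)"
          proof (intro mult_left_mono integral_mono intg o(1))
            fix \<omega> assume \<omega>: "\<omega> \<in> space (demand_space I)"
            show "g (x - D \<omega>) \<le> \<beta> ^ n * G"
              using Suc state_diff[OF x(1) _ \<omega>, of 1] D_nonneg[OF \<omega>] x(2) by auto
          qed auto
          finally show ?thesis by (simp add: prob_space)
        qed
      qed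
    qed
    then have "g x\<^sub>1 \<le> \<beta> ^ n * G" for n using assms x0 by blast
    moreover have "(\<lambda>n. \<beta> ^ n * G) \<longlonglongrightarrow> 0 * G"
      using o by (intro tendsto_mult LIMSEQ_realpow_zero tendsto_const) auto
    ultimately have "g x\<^sub>1 \<le> 0 * G" by (intro LIMSEQ_le_const) auto
    then show "opt_value \<beta> x\<^sub>1 \<le> least_value \<beta> + W x\<^sub>1" by (simp add: g_def)
  qed
qed

end

subsection \<open>The optimality inequality\<close>

text \<open>Turns the definition by sequences into one by neighbourhoods. If the bound failed in
  every ball, small values in shrinking balls at increasing indices could be assembled into one
  sequence of \<open>Y\<close> tending to \<open>x\<close> with too small a lower limit.\<close>

lemma neighbourhood_lower_bound:
  fixes u :: "nat \<Rightarrow> real \<Rightarrow> ennreal"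
  assumes "closed Y" and b: "b < (INF y\<in>{y. (\<forall>k. y k \<in> Y) \<and> y \<longlonglongrightarrow> x}. liminf (\<lambda>k. u k (y k)))"
  obtains \<delta> where "\<delta> > 0" "b < liminf (\<lambda>k. INF y\<in>Y \<inter> ball x \<delta>. u k y)"
proof (cases "x \<in> Y")
  case False
  then have "open (- Y)" "x \<in> - Y" using assms by auto
  then obtain \<delta> where \<delta>: "\<delta> > 0" "ball x \<delta> \<subseteq> - Y" by (meson openE)
  then have "Y \<inter> ball x \<delta> = {}" by blast
  \<comment> \<open>Near a point outside the closed set the infimum runs over the empty set and is
    infinite.\<close>
  then have "liminf (\<lambda>k. INF y\<in>Y \<inter> ball x \<delta>. u k y) = \<top>" by (simp add: Liminf_const)
  moreover have "b < \<top>" using b by (rule less_le_trans) simp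
  ultimately show ?thesis using that \<delta>(1) by simp
next
  case True
  show ?thesis
  proof (rule ccontr)
    assume "\<not> thesis"
    then have small: "liminf (\<lambda>k. INF y\<in>Y \<inter> ball x \<delta>. u k y) \<le> b" if "\<delta> > 0" for \<delta>
      using that by (metis not_le_imp_less \<open>\<And>\<delta>. \<lbrakk>0 < \<delta>; b < liminf (\<lambda>k. INF y\<in>Y \<inter> ball x \<delta>. u k y)\<rbrakk> \<Longrightarrow> thesis\<close>)
    obtain b' where b': "b < b'" "b' < (INF y\<in>{y. (\<forall>k. y k \<in> Y) \<and> y \<longlonglongrightarrow> x}. liminf (\<lambda>k. u k (y k)))"
      using dense[OF b] by blast
    have ex: "\<exists>k>m. \<exists>y\<in>Y \<inter> ball x \<delta>. u k y < b'" if "\<delta> > 0" for \<delta> m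
    proof (rule ccontr)
      assume *: "\<not> ?thesis"
      have "b' \<le> liminf (\<lambda>k. INF y\<in>Y \<inter> ball x \<delta>. u k y)"
      proof (intro Liminf_bounded eventually_sequentiallyI[of "Suc m"] INF_greatest)
        fix k y assume "Suc m \<le> k" "y \<in> Y \<inter> ball x \<delta>"
        then show "b' \<le> u k y" using * by (meson Suc_le_lessD not_le_imp_less)
      qed
      then show False using small[OF that] b'(1) by simp
    qed
    define P where "P n p \<longleftrightarrow> (snd p \<in> Y \<inter> ball x (1 / real (Suc n)) \<and> u (fst p) (snd p) < b')" for n :: nat and p
    obtain h where h: "\<forall>n. P n (h n) \<and> fst (h n) < fst (h (Suc n))"
    proof -
      have "\<exists>h. \<forall>n. P n (h n) \<and> fst (h n) < fst (h (Suc n))"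
      proof (rule dependent_nat_choice)
        show "\<exists>p. P 0 p" using ex[of 1 0] by (force simp: P_def)
        show "\<exists>q. P (Suc n) q \<and> fst p < fst q" for p n
          using ex[of "1 / real (Suc (Suc n))" "fst p"] by (force simp: P_def)
      qed
      then show ?thesis using that by blast
    qed
    define \<kappa> where "\<kappa> n = fst (h n)" for n
    have \<kappa>: "strict_mono \<kappa>" using h by (simp add: strict_mono_Suc_iff \<kappa>_def)
    then have inj: "inj \<kappa>" by (rule strict_mono_imp_inj_on)
    \<comment> \<open>Only the indices in the range of \<open>\<kappa>\<close> matter; the others
      are filled with \<open>x\<close> itself, which preserves convergence and membership in
      \<open>Y\<close>.\<close>
    define y where "y k = (if k \<in> range \<kappa> then snd (h (inv \<kappa> k)) else x)" for k
    have yk: "y (\<kappa> n) = snd (h n)" for n by (simp add: y_def inv_f_f[OF inj])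
    have "y \<longlonglongrightarrow> x"
    proof (rule LIMSEQ_I)
      fix r :: real assume "0 < r"
      then obtain N where N: "1 / real (Suc N) < r" using nat_approx_posE by blast
      have "norm (y k - x) < r" if "k \<ge> \<kappa> N" for k
      proof (cases "k \<in> range \<kappa>")
        case True
        then obtain n where n: "k = \<kappa> n" by blast
        then have "N \<le> n" using that \<kappa> by (simp add: strict_mono_less_eq)
        then have "1 / real (Suc n) \<le> 1 / real (Suc N)" by (simp add: frac_le)
        moreover have "norm (y k - x) < 1 / real (Suc n)"
          using h[rule_format, of n] unfolding n yk P_def by (simp add: dist_real_def abs_minus_commute)
        ultimately show ?thesis using N by simp
      qed (use \<open>0 < r\<close> in \<open>simp add: y_def\<close>)
      then show "\<exists>no. \<forall>n\<ge>no. norm (y n - x) < r" by blast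
    qed
    moreover have "\<forall>k. y k \<in> Y"
      using h True by (auto simp: y_def P_def)
    ultimately have "(INF y\<in>{y. (\<forall>k. y k \<in> Y) \<and> y \<longlonglongrightarrow> x}. liminf (\<lambda>k. u k (y k))) \<le> liminf (\<lambda>k. u k (y k))"
      by (intro INF_lower) auto
    also have "\<dots> \<le> liminf ((\<lambda>k. u k (y k)) \<circ> \<kappa>)"
      by (rule liminf_subseq_mono[OF \<kappa>])
    also have "\<dots> \<le> b'"
    proof (intro Liminf_le always_eventually allI)
      show "((\<lambda>k. u k (y k)) \<circ> \<kappa>) n \<le> b'" for n
        unfolding comp_def yk using h by (simp add: P_def \<kappa>_def less_imp_le)
    qed simp
    finally show False using b'(2) by simp
  qed
qed

context inventory_model
begin

text \<open>A sequence tending to a point of the ball around \<open>x\<close> eventually lies in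
  that ball, so one neighbourhood bound serves all points of it.\<close>

lemma liminf_relative_value_lsc:
  assumes "b < liminf_relative_value I \<beta> x"
  obtains \<delta> where "\<delta> > 0" "\<And>x'. dist x' x < \<delta> \<Longrightarrow> b < liminf_relative_value I \<beta> x'"
proof -
  obtain \<delta> where \<delta>: "\<delta> > 0" "b < liminf (\<lambda>k. INF y\<in>X \<inter> ball x \<delta>. relative_value I (\<beta> k) y)"
    by (rule neighbourhood_lower_bound[OF closed_states assms[unfolded liminf_relative_value_def]])
  show ?thesis
  proof (rule that[OF \<delta>(1)])
    fix x' assume x': "dist x' x < \<delta>"
    have "liminf (\<lambda>k. INF y\<in>X \<inter> ball x \<delta>. relative_value I (\<beta> k) y) \<le> liminf_relative_value I \<beta> x'"
      unfolding liminf_relative_value_def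
    proof (intro INF_greatest Liminf_mono)
      fix y :: "nat \<Rightarrow> real" assume y: "y \<in> {y. (\<forall>k. y k \<in> X) \<and> y \<longlonglongrightarrow> x'}"
      then have "\<forall>\<^sub>F k in sequentially. y k \<in> ball x \<delta>"
        using x' by (intro topological_tendstoD[of y x']) (auto simp: dist_commute)
      then show "\<forall>\<^sub>F k in sequentially. (INF y\<in>X \<inter> ball x \<delta>. relative_value I (\<beta> k) y) \<le> relative_value I (\<beta> k) (y k)"
        by eventually_elim (use y in \<open>auto intro!: INF_lower\<close>)
    qed
    then show "b < liminf_relative_value I \<beta> x'" using \<delta>(2) by simp
  qed
qed

text \<open>The infimum runs over uncountably many sequences; measurability comes from lower
  semicontinuity, as strict superlevel sets are open.\<close>

lemma liminf_relative_value_measurable [measurable]: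
  "liminf_relative_value I \<beta> \<in> borel_measurable borel"
proof (rule borel_measurableI_greater)
  fix b
  have "open {x. b < liminf_relative_value I \<beta> x}"
    unfolding open_dist by (auto elim!: liminf_relative_value_lsc)
  then show "{x \<in> space borel. b < liminf_relative_value I \<beta> x} \<in> sets borel" by simp
qed

lemma liminf_relative_value_sequence:
  assumes "x \<longlonglongrightarrow> z"
  shows "liminf_relative_value I \<beta> z \<le> liminf (\<lambda>n. liminf_relative_value I \<beta> (x n))"
  unfolding le_Liminf_iff
proof safe
  fix b assume "b < liminf_relative_value I \<beta> z"
  from liminf_relative_value_lsc[OF this]
  obtain \<delta> where \<delta>: "\<delta> > 0" "\<And>x'. dist x' z < \<delta> \<Longrightarrow> b < liminf_relative_value I \<beta> x'"
    by blast
  show "\<forall>\<^sub>F n in sequentially. b < liminf_relative_value I \<beta> (x n)"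
    using tendstoD[OF assms \<delta>(1)] by eventually_elim (rule \<delta>(2))
qed

text \<open>Lower semicontinuity survives the expectation by Fatou's lemma; this is needed for the
  minimizer of \<open>H\<close>.\<close>

lemma demand_mean_lsc:
  assumes "x \<longlonglongrightarrow> z"
  shows "demand_mean (liminf_relative_value I \<beta>) z \<le> liminf (\<lambda>n. demand_mean (liminf_relative_value I \<beta>) (x n))"
proof -
  have "demand_mean (liminf_relative_value I \<beta>) z \<le>
     (\<integral>\<^sup>+\<omega>. liminf (\<lambda>n. liminf_relative_value I \<beta> (x n - D \<omega>)) \<partial>demand_space I)"
    unfolding demand_mean_def
    by (intro nn_integral_mono liminf_relative_value_sequence tendsto_diff assms tendsto_const)
  also have "\<dots> \<le> liminf (\<lambda>n. demand_mean (liminf_relative_value I \<beta>) (x n))"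
    unfolding demand_mean_def by (intro nn_integral_liminf) simp
  finally show ?thesis .
qed

section \<open>Limits along a sequence of discount factors\<close>

lemma relative_value_measurable:
  assumes "optimal_threshold \<beta> s S"
  shows "relative_value I \<beta> \<in> borel_measurable (state_space I)"
proof -
  have "(\<lambda>x. ennreal (opt_value \<beta> x - least_value \<beta>)) \<in> borel_measurable (state_space I)"
    using value_measurable[OF assms] by simp
  then show ?thesis
    by (rule measurable_cong[THEN iffD1, rotated]) (simp add: relative_value_eq optimal_thresholdD[OF assms])
qed

lemma demand_mean_relative_value:
  assumes opt: "optimal_threshold \<beta> s S" and x: "x \<in> X"
  shows "demand_mean (relative_value I \<beta>) x = ennreal (value_mean \<beta> x - least_value \<beta>)"
proof -
  note o = optimal_thresholdD[OF opt]
  have "demand_mean (relative_value I \<beta>) x = demand_mean (\<lambda>y. ennreal (opt_value \<beta> y - least_value \<beta>)) x"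
    by (rule demand_mean_cong[OF _ x]) (simp add: relative_value_eq o)
  also have "\<dots> = ennreal (\<integral>\<omega>. opt_value \<beta> (x - D \<omega>) - least_value \<beta> \<partial>demand_space I)"
    unfolding demand_mean_def
    by (rule nn_integral_eq_integral)
       (use value_integrable[OF opt x] in \<open>auto intro!: AE_I2 least_value_le o state_diff x\<close>)
  also have "(\<integral>\<omega>. opt_value \<beta> (x - D \<omega>) - least_value \<beta> \<partial>demand_space I) = value_mean \<beta> x - least_value \<beta>"
    using value_integrable[OF opt x] by (simp add: value_mean_def prob_space)
  finally show ?thesis .
qed

lemma demand_mean_relative_value_liminf:
  assumes opt: "\<And>k. optimal_threshold (\<beta> k) (s k) (S k)" and z: "\<And>k. z k \<in> X" "z \<longlonglongrightarrow> z'"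
  shows "demand_mean (liminf_relative_value I \<beta>) z' \<le> liminf (\<lambda>k. demand_mean (relative_value I (\<beta> k)) (z k))"
proof -
  have "demand_mean (liminf_relative_value I \<beta>) z' \<le>
     (\<integral>\<^sup>+\<omega>. liminf (\<lambda>k. relative_value I (\<beta> k) (z k - D \<omega>)) \<partial>demand_space I)"
    unfolding demand_mean_def
  proof (intro nn_integral_mono)
    fix \<omega> assume "\<omega> \<in> space (demand_space I)"
    then show "liminf_relative_value I \<beta> (z' - D \<omega>) \<le> liminf (\<lambda>k. relative_value I (\<beta> k) (z k - D \<omega>))"
      unfolding liminf_relative_value_def
      by (intro INF_lower) (auto intro!: state_diff z tendsto_diff)
  qed
  also have "\<dots> \<le> liminf (\<lambda>k. demand_mean (relative_value I (\<beta> k)) (z k))"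
    unfolding demand_mean_def
    by (intro nn_integral_liminf measurable_compose[OF subtract_demand_measurable relative_value_measurable[OF opt]] z) simp
  finally show ?thesis .
qed

lemma tendsto_states: "(\<And>k. z k \<in> X) \<Longrightarrow> z \<longlonglongrightarrow> z' \<Longrightarrow> z' \<in> X"
  using closed_states closed_sequentially by blast

lemma tendsto_L:
  assumes "\<And>k. z k \<in> X" "z \<longlonglongrightarrow> z'"
  shows "(\<lambda>k. L (z k)) \<longlonglongrightarrow> L z'"
  using holding_continuous tendsto_states[OF assms] assms unfolding continuous_on_sequentially
  by (auto simp: comp_def)

lemma optimality_inequality:
  assumes opt: "\<And>k. optimal_threshold (\<beta> k) (s k) (S k)"
    and \<beta>: "\<beta> \<longlonglongrightarrow> 1" and w: "(\<lambda>k. (1 - \<beta> k) * least_value (\<beta> k)) \<longlonglongrightarrow> w"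
    and s: "s \<longlonglongrightarrow> s'" and S: "S \<longlonglongrightarrow> S'" and x: "x \<in> X"
  shows "ennreal (stage_cost I x (sS_action s' S' x)) +
      demand_mean (liminf_relative_value I \<beta>) (x + sS_action s' S' x)
    \<le> ennreal w + liminf_relative_value I \<beta> x"
    (is "?lhs \<le> _")
proof -
  note o = optimal_thresholdD[OF opt]
  have sS: "s' \<le> S'" by (rule LIMSEQ_le[OF s S]) (use o in blast)
  have claim: "?lhs \<le> ennreal w + liminf (\<lambda>k. relative_value I (\<beta> k) (y k))"
    if y: "\<And>k. y k \<in> X" "y \<longlonglongrightarrow> x" for y
  proof -
    \<comment> \<open>Away from \<open>s'\<close> the decisions of the \<open>k\<close>-th policy
      eventually agree with those of the limit policy. At \<open>s'\<close> the limit policy does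
      not order while \<open>y k\<close> may lie below \<open>s k\<close>; the maximum removes these
      orders and keeps the limit \<open>x\<close>.\<close>
    define y' where "y' k = (if x = s' then max (y k) (s k) else y k)" for k
    have y'X: "y' k \<in> X" for k using y o by (auto simp: y'_def max_def)
    have y'_lim: "y' \<longlonglongrightarrow> x"
    proof (cases "x = s'")
      case True
      then have "(\<lambda>k. max (y k) (s k)) \<longlonglongrightarrow> max x x" using y s by (intro tendsto_max) auto
      then show ?thesis using True by (simp add: y'_def[abs_def])
    qed (use y in \<open>simp add: y'_def[abs_def]\<close>)
    have y'_le: "opt_value (\<beta> k) (y' k) \<le> opt_value (\<beta> k) (y k)" for k
    proof (cases "x = s' \<and> y k < s k")
      case True
      moreover have "c * (s k - y k) \<ge> 0" using True unit_cost_pos by simp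
      ultimately show ?thesis
        using value_below_threshold[OF opt y(1), of k k] by (simp add: y'_def max_def)
    qed (auto simp: y'_def max_def)
    define a where "a k = sS_action (s k) (S k) (y' k)" for k
    define z where "z k = y' k + a k" for k
    have aA: "a k \<in> A" for k
      unfolding a_def by (rule decision_rule_action[OF sS_decision_rules y'X]) (rule o)+
    have zX: "z k \<in> X" for k
      unfolding z_def by (rule state_add[OF y'X aA])
    have limits: "z \<longlonglongrightarrow> x + sS_action s' S' x \<and>
      (\<lambda>k. stage_cost I (y' k) (a k)) \<longlonglongrightarrow> stage_cost I x (sS_action s' S' x)"
    proof (cases "x < s'")
      case True
      have "(\<lambda>k. y' k - s k) \<longlonglongrightarrow> x - s'" using y'_lim s by (rule tendsto_diff)
      then have ev: "\<forall>\<^sub>F k in sequentially. y' k - s k < 0"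
        using True by (intro order_tendstoD(2)) auto
      have "\<forall>\<^sub>F k in sequentially. S k = z k"
        using ev by eventually_elim (simp add: z_def a_def sS_action_def)
      then have z: "z \<longlonglongrightarrow> S'" by (rule Lim_transform_eventually[OF S])
      have "\<forall>\<^sub>F k in sequentially. K + c * (S k - y' k) + L (z k) = stage_cost I (y' k) (a k)"
        using ev
      proof eventually_elim
        case (elim k)
        then show ?case
          using o(5)[of k] by (simp add: stage_cost_def z_def a_def sS_action_def)
      qed
      moreover have "(\<lambda>k. K + c * (S k - y' k) + L (z k)) \<longlonglongrightarrow> K + c * (S' - x) + L S'"
        by (intro tendsto_intros S y'_lim tendsto_L zX z)
      ultimately have "(\<lambda>k. stage_cost I (y' k) (a k)) \<longlonglongrightarrow> K + c * (S' - x) + L S'"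
        by (rule Lim_transform_eventually[rotated])
      then show ?thesis using z True sS by (simp add: stage_cost_def sS_action_def)
    next
      case False
      have ev: "\<forall>\<^sub>F k in sequentially. s k \<le> y' k"
      proof (cases "x = s'")
        case True
        then show ?thesis by (simp add: y'_def)
      next
        case False
        have "(\<lambda>k. s k - y' k) \<longlonglongrightarrow> s' - x" using s y'_lim by (rule tendsto_diff)
        then have "\<forall>\<^sub>F k in sequentially. s k - y' k < 0"
          using False \<open>\<not> x < s'\<close> by (intro order_tendstoD(2)) auto
        then show ?thesis by eventually_elim simp
      qed
      have "\<forall>\<^sub>F k in sequentially. y' k = z k"
        using ev by eventually_elim (simp add: z_def a_def sS_action_def)
      then have z: "z \<longlonglongrightarrow> x" by (rule Lim_transform_eventually[OF y'_lim])
      have "\<forall>\<^sub>F k in sequentially. L (z k) = stage_cost I (y' k) (a k)"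
        using ev by eventually_elim (simp add: stage_cost_def z_def a_def sS_action_def)
      then have "(\<lambda>k. stage_cost I (y' k) (a k)) \<longlonglongrightarrow> L x"
        by (rule Lim_transform_eventually[OF tendsto_L[OF zX z]])
      then show ?thesis using z False by (simp add: stage_cost_def sS_action_def)
    qed
    define e where "e k = demand_mean (relative_value I (\<beta> k)) (z k)" for k
    define U where "U k = relative_value I (\<beta> k) (y k)" for k
    have ineq: "ennreal (stage_cost I (y' k) (a k)) + ennreal (\<beta> k) * e k
        \<le> ennreal ((1 - \<beta> k) * least_value (\<beta> k)) + U k" for k
    proof -
      have "opt_value (\<beta> k) (y' k) = stage_cost I (y' k) (a k) + \<beta> k * value_mean (\<beta> k) (z k)"
        unfolding z_def a_def by (rule value_threshold[OF opt y'X])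
      \<comment> \<open>The evaluation equation minus \<open>\<beta> k\<close> times the least
        value, with the difference split into the scaled least value and a relative value.\<close>
      then have "stage_cost I (y' k) (a k) + \<beta> k * (value_mean (\<beta> k) (z k) - least_value (\<beta> k))
         \<le> (1 - \<beta> k) * least_value (\<beta> k) + (opt_value (\<beta> k) (y k) - least_value (\<beta> k))"
        using y'_le[of k] by (simp add: algebra_simps)
      then have "ennreal (stage_cost I (y' k) (a k) + \<beta> k * (value_mean (\<beta> k) (z k) - least_value (\<beta> k)))
         \<le> ennreal ((1 - \<beta> k) * least_value (\<beta> k) + (opt_value (\<beta> k) (y k) - least_value (\<beta> k)))"
        by (rule ennreal_leI)
      moreover have "least_value (\<beta> k) \<le> value_mean (\<beta> k) (z k)" "least_value (\<beta> k) \<le> opt_value (\<beta> k) (y k)"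
        using least_value_le_value_mean[OF opt zX] least_value_le[OF o(1,2) y(1)] by auto
      ultimately show ?thesis
        unfolding e_def U_def demand_mean_relative_value[OF opt zX] relative_value_eq[OF o(1,2) y(1)]
        using o(1,2)[of k] stage_cost_nonneg[OF y'X aA, of k k] least_value_nonneg[of "\<beta> k"]
        by (simp add: ennreal_mult)
    qed
    \<comment> \<open>First \<open>U\<close> is made convergent to its lower limit, then
      \<open>e\<close> along that subsequence, so that both sides of \<open>ineq\<close> converge.
      Thinning out can only raise the lower limit of \<open>e\<close>, which is the favourable
      direction.\<close>
    obtain q where q: "strict_mono q" "(U \<circ> q) \<longlonglongrightarrow> liminf U" using liminf_subseq_lim by blast
    obtain q' where q': "strict_mono q'" "((e \<circ> q) \<circ> q') \<longlonglongrightarrow> liminf (e \<circ> q)" using liminf_subseq_lim by blast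
    define r where "r = q \<circ> q'"
    have r: "strict_mono r" using q q' unfolding r_def by (intro strict_mono_o)
    have lim_r: "(\<lambda>k. f (r k)) \<longlonglongrightarrow> l" if "f \<longlonglongrightarrow> l" for f :: "nat \<Rightarrow> real" and l
      using LIMSEQ_subseq_LIMSEQ[OF that r] by (simp add: comp_def)
    have "(\<lambda>k. ennreal (stage_cost I (y' (r k)) (a (r k))) + ennreal (\<beta> (r k)) * e (r k)) \<longlonglongrightarrow>
       ennreal (stage_cost I x (sS_action s' S' x)) + ennreal 1 * liminf (e \<circ> q)"
    proof (intro tendsto_add tendsto_ennrealI tendsto_mult_ennreal)
      show "(\<lambda>k. stage_cost I (y' (r k)) (a (r k))) \<longlonglongrightarrow> stage_cost I x (sS_action s' S' x)"
        using lim_r limits by blast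
      show "(\<lambda>k. \<beta> (r k)) \<longlonglongrightarrow> 1" by (rule lim_r[OF \<beta>])
      show "(\<lambda>k. e (r k)) \<longlonglongrightarrow> liminf (e \<circ> q)" using q'(2) by (simp add: r_def comp_def)
    qed auto
    moreover have "(\<lambda>k. ennreal ((1 - \<beta> (r k)) * least_value (\<beta> (r k))) + U (r k)) \<longlonglongrightarrow> ennreal w + liminf U"
    proof (intro tendsto_add tendsto_ennrealI)
      show "(\<lambda>k. (1 - \<beta> (r k)) * least_value (\<beta> (r k))) \<longlonglongrightarrow> w" using lim_r[OF w] .
      show "(\<lambda>k. U (r k)) \<longlonglongrightarrow> liminf U"
        using LIMSEQ_subseq_LIMSEQ[OF q(2) q'(1)] by (simp add: r_def comp_def)
    qed
    ultimately have "ennreal (stage_cost I x (sS_action s' S' x)) + ennreal 1 * liminf (e \<circ> q) \<le> ennreal w + liminf U"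
      by (rule LIMSEQ_le) (use ineq in blast)
    moreover have "demand_mean (liminf_relative_value I \<beta>) (x + sS_action s' S' x) \<le> liminf (e \<circ> q)"
    proof -
      have "demand_mean (liminf_relative_value I \<beta>) (x + sS_action s' S' x) \<le> liminf e"
        unfolding e_def using limits by (intro demand_mean_relative_value_liminf[OF opt zX]) simp
      also have "\<dots> \<le> liminf (e \<circ> q)" by (rule liminf_subseq_mono[OF q(1)])
      finally show ?thesis .
    qed
    ultimately show ?thesis
      unfolding U_def[abs_def] by (auto intro: order_trans[OF add_left_mono])
  qed
  \<comment> \<open>Subtracting the finite constant lets the infimum over all sequences
    \<open>y\<close> be taken on one side alone.\<close>
  have "?lhs - ennreal w \<le> liminf_relative_value I \<beta> x"
    by (subst liminf_relative_value_def, intro INF_greatest)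
       (use claim in \<open>auto simp: ennreal_minus_le_iff\<close>)
  then show ?thesis by (simp add: ennreal_minus_le_iff)
qed

text \<open>The constant sequence \<open>x\<close> is admissible, and along it the relative values
  are uniformly bounded.\<close>

lemma liminf_relative_value_finite:
  assumes opt: "\<And>k. optimal_threshold (\<beta> k) (s k) (S k)" and x: "x \<in> X"
  shows "liminf_relative_value I \<beta> x < \<top>"
proof -
  note o = optimal_thresholdD[OF opt]
  obtain B where B: "\<And>\<beta> s S. optimal_threshold \<beta> s S \<Longrightarrow> opt_value \<beta> x \<le> least_value \<beta> + B"
    by (rule relative_value_bounded[OF x]) blast
  have "liminf_relative_value I \<beta> x \<le> liminf (\<lambda>k. relative_value I (\<beta> k) x)"
    unfolding liminf_relative_value_def using x by (intro INF_lower) auto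
  also have "\<dots> \<le> ennreal B"
    using B[OF opt] by (intro Liminf_le always_eventually)
      (auto simp: relative_value_eq o x intro!: ennreal_leI simp: algebra_simps)
  also have "\<dots> < \<top>" by simp
  finally show ?thesis .
qed

text \<open>The optimality inequality iterated \<open>N\<close> times leaves
  \<open>real N * w\<close> plus the lower limit at the initial state. The latter is finite and
  vanishes after division by \<open>N\<close>.\<close>

lemma threshold_average_cost_le:
  assumes opt: "\<And>k. optimal_threshold (\<beta> k) (s k) (S k)"
    and \<beta>: "\<beta> \<longlonglongrightarrow> 1" and w: "(\<lambda>k. (1 - \<beta> k) * least_value (\<beta> k)) \<longlonglongrightarrow> w"
    and s: "s \<longlonglongrightarrow> s'" and S: "S \<longlonglongrightarrow> S'" and x: "x \<in> X"
  shows "average_cost I (sS_policy I s' S') x \<le> ennreal w"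
proof -
  note o = optimal_thresholdD[OF opt]
  let ?u = "liminf_relative_value I \<beta>" and ?f = "\<lambda>_::nat. sS_action s' S'"
  have sS: "s' \<le> S'" by (rule LIMSEQ_le[OF s S]) (use o in blast)
  have f: "?f \<in> decision_rules"
    using tendsto_states[OF _ s] tendsto_states[OF _ S] o sS by (intro sS_decision_rules) auto
  have w0: "w \<ge> 0"
  proof (rule LIMSEQ_le_const[OF w])
    have "0 \<le> (1 - \<beta> k) * least_value (\<beta> k)" for k
      using o(2)[of k] least_value_nonneg[of "\<beta> k"] by simp
    then show "\<exists>N. \<forall>n\<ge>N. 0 \<le> (1 - \<beta> n) * least_value (\<beta> n)" by blast
  qed
  have u: "?u \<in> borel_measurable (state_space I)"
    by (rule borel_measurable_state_space) simp
  have bound: "horizon_cost 1 ?f N y \<le> ennreal (real N * w) + ?u y" if "y \<in> X" for N y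
    using that
  proof (induction N arbitrary: y)
    case 0
    then show ?case by (simp add: horizon_cost_def)
  next
    case (Suc N)
    let ?z = "y + sS_action s' S' y"
    have z: "?z \<in> X" using order_state[OF f Suc.prems] by simp
    have "horizon_cost 1 ?f (Suc N) y =
       ennreal (stage_cost I y (sS_action s' S' y)) + demand_mean (horizon_cost 1 ?f N) ?z"
      by (subst horizon_cost_Suc[OF f Suc.prems]) (auto simp: comp_def)
    also have "\<dots> \<le> ennreal (stage_cost I y (sS_action s' S' y)) + demand_mean (\<lambda>y. ennreal (real N * w) + ?u y) ?z"
      by (intro add_left_mono demand_mean_mono Suc.IH z)
    also have "\<dots> = ennreal (real N * w) + (ennreal (stage_cost I y (sS_action s' S' y)) + demand_mean ?u ?z)"
      by (subst demand_mean_add[OF _ u z]) (auto simp: demand_mean_const ac_simps)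
    also have "\<dots> \<le> ennreal (real N * w) + (ennreal w + ?u y)"
      by (intro add_left_mono optimality_inequality[OF opt \<beta> w s S Suc.prems])
    also have "\<dots> = ennreal (real (Suc N) * w) + ?u y"
    proof -
      have "ennreal (real N * w) + ennreal w = ennreal (real (Suc N) * w)"
        using w0 by (subst ennreal_plus[symmetric]) (auto simp: algebra_simps)
      then show ?thesis by (metis add.assoc)
    qed
    finally show ?case .
  qed
  define B where "B = enn2real (?u x)"
  have B: "?u x = ennreal B" using liminf_relative_value_finite[OF opt x] by (simp add: B_def)
  have "average_cost I (sS_policy I s' S') x = limsup (\<lambda>N. ennreal (1 / real N) * horizon_cost 1 ?f N x)"
    unfolding sS_policy_eq by (rule markov_average_cost[OF f x])
  also have "\<dots> \<le> limsup (\<lambda>N. ennreal (w + B * (1 / real N)))"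
  proof (rule Limsup_mono)
    show "\<forall>\<^sub>F N in sequentially. ennreal (1 / real N) * horizon_cost 1 ?f N x \<le> ennreal (w + B * (1 / real N))"
      using eventually_gt_at_top[of 0]
    proof eventually_elim
      case (elim N)
      have "ennreal (1 / real N) * horizon_cost 1 ?f N x \<le> ennreal (1 / real N) * ennreal (real N * w + B)"
        using bound[OF x, of N] w0 unfolding B by (intro mult_left_mono) (auto simp: B_def)
      also have "\<dots> = ennreal (w + B * (1 / real N))"
        using elim w0 by (subst ennreal_mult[symmetric]) (auto simp: B_def field_simps)
      finally show ?case .
    qed
  qed
  also have "(\<lambda>N. ennreal (w + B * (1 / real N))) \<longlonglongrightarrow> ennreal (w + B * 0)"
    by (intro tendsto_intros lim_1_over_n)
  then have "limsup (\<lambda>N. ennreal (w + B * (1 / real N))) = ennreal w"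
    by (simp add: lim_imp_Limsup)
  finally show ?thesis .
qed

end

subsection \<open>Average costs and the limit of scaled minimal values\<close>

text \<open>Abel summation: the discounted sum is a convex combination of the partial sums, with
  weights \<open>\<gamma> ^ T\<close> and \<open>(1 - \<gamma>) * \<gamma> ^ N\<close>, so a linear
  bound on partial sums carries over.\<close>

lemma discounted_sum_le:
  fixes e :: "nat \<Rightarrow> real"
  assumes \<gamma>: "0 \<le> \<gamma>" "\<gamma> < 1" and "0 \<le> a" and S: "\<And>N. (\<Sum>t<N. e t) \<le> B + real N * a"
  shows "(\<Sum>t<T. \<gamma> ^ t * e t) \<le> B + a / (1 - \<gamma>)"
proof -
  define S where "S N = (\<Sum>t<N. e t)" for N
  have S_le: "S N \<le> B + real N * a" for N unfolding S_def by (rule S)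
  have "(\<Sum>t<T. \<gamma> ^ t * e t) = \<gamma> ^ T * S T + (1 - \<gamma>) * (\<Sum>N<T. \<gamma> ^ N * S (Suc N))"
    by (induction T) (simp_all add: S_def algebra_simps)
  also have "\<dots> \<le> \<gamma> ^ T * (B + real T * a) + (1 - \<gamma>) * (\<Sum>N<T. \<gamma> ^ N * (B + real (Suc N) * a))"
    using \<gamma> by (intro add_mono mult_left_mono sum_mono S_le) auto
  also have "\<dots> = B + a * (\<Sum>t<T. \<gamma> ^ t)"
    by (induction T) (simp_all add: algebra_simps)
  also have "(\<Sum>t<T. \<gamma> ^ t) \<le> 1 / (1 - \<gamma>)"
    using \<gamma> by (simp add: sum_gp_strict divide_right_mono)
  finally show ?thesis using \<open>0 \<le> a\<close> by (simp add: mult_left_mono)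
qed

text \<open>The average bound holds from some index \<open>M\<close> on; \<open>B\<close> absorbs
  the earlier terms and does not depend on \<open>\<gamma>\<close>.\<close>

lemma discounted_series_le:
  fixes e :: "nat \<Rightarrow> ennreal"
  assumes a: "limsup (\<lambda>N. ennreal (1 / real N) * (\<Sum>t<N. e t)) < ennreal a"
  obtains B where "B \<ge> 0" "\<And>\<gamma>. 0 \<le> \<gamma> \<Longrightarrow> \<gamma> < 1 \<Longrightarrow> (\<Sum>t. ennreal (\<gamma> ^ t) * e t) \<le> ennreal (B + a / (1 - \<gamma>))"
proof -
  have "0 < ennreal a" by (rule le_less_trans[OF _ a]) simp
  then have "a > 0" by simp
  have "\<forall>\<^sub>F N in sequentially. ennreal (1 / real N) * (\<Sum>t<N. e t) < ennreal a"
    using a by (rule Limsup_lessD)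
  then obtain M where M: "\<And>N. N \<ge> M \<Longrightarrow> ennreal (1 / real N) * (\<Sum>t<N. e t) < ennreal a"
    by (auto simp: eventually_sequentially)
  have le: "(\<Sum>t<N. e t) \<le> ennreal (real N * a)" if N: "N \<ge> M" "N > 0" for N
  proof -
    have "(\<Sum>t<N. e t) = ennreal (real N * (1 / real N)) * (\<Sum>t<N. e t)" using N by simp
    also have "\<dots> = ennreal (real N) * (ennreal (1 / real N) * (\<Sum>t<N. e t))"
      by (subst ennreal_mult) (auto simp: mult.assoc)
    also have "\<dots> \<le> ennreal (real N) * ennreal a"
      by (intro mult_left_mono less_imp_le[OF M[OF N(1)]]) simp
    finally show ?thesis using \<open>a > 0\<close> by (simp add: ennreal_mult)
  qed
  have "e t < \<top>" for t
  proof -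
    \<comment> \<open>The partial sum is extended to at least \<open>M\<close> terms, where the
      average bound makes it finite.\<close>
    have "e t \<le> (\<Sum>t<Suc (max M t). e t)"
      by (rule member_le_sum) auto
    also have "\<dots> < \<top>" by (rule le_less_trans[OF le]) auto
    finally show ?thesis .
  qed
  then have e: "e t = ennreal (enn2real (e t))" for t by simp
  define r where "r t = enn2real (e t)" for t
  have e: "e = (\<lambda>t. ennreal (r t))" using e by (auto simp: r_def)
  have r: "r t \<ge> 0" for t by (simp add: r_def)
  define B where "B = (\<Sum>t<M. r t)"
  have B: "B \<ge> 0" unfolding B_def using r by (simp add: sum_nonneg)
  have sum_r: "(\<Sum>t<N. r t) \<le> B + real N * a" for N
  proof (cases "N \<ge> M \<and> N > 0")
    case True
    then have "ennreal (\<Sum>t<N. r t) \<le> ennreal (real N * a)" using le[of N] r by (simp add: e)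
    then show ?thesis using B \<open>a > 0\<close> by (simp add: ennreal_le_iff)
  next
    case False
    then have "(\<Sum>t<N. r t) \<le> B" unfolding B_def using r by (intro sum_mono2) auto
    then show ?thesis using \<open>a > 0\<close> by (simp add: add_increasing2)
  qed
  show ?thesis
  proof (rule that[OF B])
    fix \<gamma> :: real assume \<gamma>: "0 \<le> \<gamma>" "\<gamma> < 1"
    have "(\<Sum>t. ennreal (\<gamma> ^ t) * e t) = (SUP T. \<Sum>t<T. ennreal (\<gamma> ^ t) * e t)"
      by (rule suminf_eq_SUP)
    also have "\<dots> \<le> ennreal (B + a / (1 - \<gamma>))"
    proof (rule SUP_least)
      fix T
      have "(\<Sum>t<T. ennreal (\<gamma> ^ t) * e t) = ennreal (\<Sum>t<T. \<gamma> ^ t * r t)"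
        using \<gamma> r by (simp add: e ennreal_mult sum_nonneg flip: sum_ennreal)
      also have "\<dots> \<le> ennreal (B + a / (1 - \<gamma>))"
        using \<open>a > 0\<close> by (intro ennreal_leI discounted_sum_le[OF \<gamma> _ sum_r]) simp
      finally show "(\<Sum>t<T. ennreal (\<gamma> ^ t) * e t) \<le> ennreal (B + a / (1 - \<gamma>))" .
    qed
    finally show "(\<Sum>t. ennreal (\<gamma> ^ t) * e t) \<le> ennreal (B + a / (1 - \<gamma>))" .
  qed
qed

context inventory_model
begin

text \<open>If the average cost were below \<open>a < l\<close>, all discounted costs would be at
  most \<open>B + a / (1 - \<gamma> n)\<close>. Multiplication by \<open>1 - \<gamma> n\<close>
  removes \<open>B\<close> in the limit and gives \<open>l \<le> a\<close>.\<close>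

lemma scaled_least_value_le_average_cost:
  assumes \<pi>: "\<pi> \<in> policies I" and x: "x \<in> X"
    and \<gamma>: "\<And>n. 0 \<le> \<gamma> n" "\<And>n. \<gamma> n < 1" "\<gamma> \<longlonglongrightarrow> 1"
    and l: "(\<lambda>n. (1 - \<gamma> n) * least_value (\<gamma> n)) \<longlonglongrightarrow> l"
  shows "ennreal l \<le> average_cost I \<pi> x"
proof (rule ccontr)
  assume "\<not> ?thesis"
  then obtain a' where a': "average_cost I \<pi> x < a'" "a' < ennreal l"
    using dense[of "average_cost I \<pi> x" "ennreal l"] by (auto simp: not_le)
  define a where "a = enn2real a'"
  have "a' < \<top>" using a'(2) by (rule less_trans) simp
  then have aa: "a' = ennreal a" by (simp add: a_def)
  obtain B where "B \<ge> 0" and series: "\<And>\<gamma>. 0 \<le> \<gamma> \<Longrightarrow> \<gamma> < 1 \<Longrightarrow>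
      (\<Sum>t. ennreal (\<gamma> ^ t) * (\<integral>\<^sup>+\<omega>. ennreal (stage_cost I (fst (\<omega> t)) (snd (\<omega> t))) \<partial>trajectories I \<pi> x))
        \<le> ennreal (B + a / (1 - \<gamma>))"
    by (rule discounted_series_le[OF a'(1)[unfolded aa average_cost_series[OF \<pi> x]]]) blast
  have a0: "a \<ge> 0" by (simp add: a_def)
  have "(1 - \<gamma> n) * least_value (\<gamma> n) \<le> (1 - \<gamma> n) * B + a" for n
  proof -
    have "ennreal (least_value (\<gamma> n)) = min_value I (\<gamma> n)"
      by (simp add: min_value_finite \<gamma>)
    also have "\<dots> \<le> discounted_value I (\<gamma> n) x"
      unfolding min_value_def using x by (rule INF_lower)
    also have "\<dots> \<le> discounted_cost I (\<gamma> n) \<pi> x"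
      unfolding discounted_value_def using \<pi> by (rule INF_lower)
    also have "\<dots> \<le> ennreal (B + a / (1 - \<gamma> n))" 
      unfolding discounted_cost_series[OF \<pi> x \<gamma>(1)] by (rule series[OF \<gamma>(1,2)])
    finally have "least_value (\<gamma> n) \<le> B + a / (1 - \<gamma> n)"
      using \<open>B \<ge> 0\<close> a0 \<gamma>(2)[of n] by (subst (asm) ennreal_le_iff) auto
    then have "(1 - \<gamma> n) * least_value (\<gamma> n) \<le> (1 - \<gamma> n) * (B + a / (1 - \<gamma> n))"
      using \<gamma>(2)[of n] by (intro mult_left_mono) auto
    also have "\<dots> = (1 - \<gamma> n) * B + a" using \<gamma>(2)[of n] by (simp add: field_simps)
    finally show ?thesis .
  qed
  moreover have "(\<lambda>n. (1 - \<gamma> n) * B + a) \<longlonglongrightarrow> (1 - 1) * B + a"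
    by (intro tendsto_intros \<gamma>)
  ultimately have "l \<le> (1 - 1) * B + a" by (intro LIMSEQ_le[OF l]) auto
  then show False using a'(2) a0 unfolding aa by (simp add: ennreal_less_iff)
qed

section \<open>Agreement of all limits of scaled least values\<close>

context
  fixes \<alpha>\<^sub>0 :: real and s' S' :: "real \<Rightarrow> real" and l\<^sub>0 :: ereal and \<beta>\<^sub>1 :: real
  assumes \<alpha>\<^sub>0: "0 \<le> \<alpha>\<^sub>0" "\<alpha>\<^sub>0 < 1"
    and opt: "\<And>\<beta>. \<alpha>\<^sub>0 < \<beta> \<Longrightarrow> \<beta> < 1 \<Longrightarrow> optimal_threshold \<beta> (s' \<beta>) (S' \<beta>)"
    and \<beta>\<^sub>1: "\<beta>\<^sub>1 < 1"
    and left: "((\<lambda>x. ereal (mean_after_demand I (discounted_holding I \<beta>\<^sub>1) x)) \<longlongrightarrow> l\<^sub>0) (inf at_bot (principal X))"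
      "l\<^sub>0 > -\<infinity>"
begin

lemma threshold_sequence_bounded:
  assumes \<gamma>: "\<And>n. \<alpha>\<^sub>0 < \<gamma> n" "\<And>n. \<gamma> n < 1" "\<gamma> \<longlonglongrightarrow> 1"
  shows "bounded (range (\<lambda>n. (s' (\<gamma> n), S' (\<gamma> n))))"
proof -
  obtain \<beta>\<^sub>2 lo hi where b: "\<beta>\<^sub>2 < 1"
    "\<And>\<beta> s S. \<beta>\<^sub>2 \<le> \<beta> \<Longrightarrow> optimal_threshold \<beta> s S \<Longrightarrow> lo \<le> s \<and> S \<le> hi"
    by (rule thresholds_bounded[OF \<beta>\<^sub>1 left]) blast
  obtain N where N: "\<And>n. n \<ge> N \<Longrightarrow> \<beta>\<^sub>2 < \<gamma> n"
    using order_tendstoD(1)[OF \<gamma>(3) b(1)] by (auto simp: eventually_sequentially)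
  have mem: "(s' (\<gamma> n), S' (\<gamma> n)) \<in> (\<lambda>n. (s' (\<gamma> n), S' (\<gamma> n))) ` {..<N} \<union> {lo..hi} \<times> {lo..hi}" for n
  proof (cases "n < N")
    case False
    note o = opt[OF \<gamma>(1,2), of n]
    show ?thesis
      using b(2)[OF _ o] N[of n] optimal_thresholdD(5)[OF o] False by auto
  qed simp
  have "bounded ((\<lambda>n. (s' (\<gamma> n), S' (\<gamma> n))) ` {..<N} \<union> {lo..hi} \<times> {lo..hi})"
    by (simp add: bounded_Un finite_imp_bounded bounded_Times)
  then show ?thesis by (rule bounded_subset) (intro image_subsetI mem)
qed

text \<open>The two sequences play different roles: \<open>\<gamma>\<close> supplies a limiting
  threshold policy of average cost at most \<open>l\<close>, and \<open>\<gamma>'\<close> the lower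
  bound \<open>l'\<close> for every policy. Exchanging them yields equality.\<close>

lemma scaled_least_value_limits_le:
  assumes \<gamma>: "\<And>n. \<alpha>\<^sub>0 < \<gamma> n" "\<And>n. \<gamma> n < 1" "\<gamma> \<longlonglongrightarrow> 1"
    and \<gamma>': "\<And>n. \<alpha>\<^sub>0 < \<gamma>' n" "\<And>n. \<gamma>' n < 1" "\<gamma>' \<longlonglongrightarrow> 1"
    and l: "(\<lambda>n. (1 - \<gamma> n) * least_value (\<gamma> n)) \<longlonglongrightarrow> l"
    and l': "(\<lambda>n. (1 - \<gamma>' n) * least_value (\<gamma>' n)) \<longlonglongrightarrow> l'"
  shows "l' \<le> l"
proof -
  obtain p r where r: "strict_mono r" "((\<lambda>n. (s' (\<gamma> n), S' (\<gamma> n))) \<circ> r) \<longlonglongrightarrow> p"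
    using bounded_imp_convergent_subsequence[OF threshold_sequence_bounded[OF \<gamma>]] by blast
  have sS: "(\<lambda>n. s' (\<gamma> (r n))) \<longlonglongrightarrow> fst p" "(\<lambda>n. S' (\<gamma> (r n))) \<longlonglongrightarrow> snd p"
    using tendsto_fst[OF r(2)] tendsto_snd[OF r(2)] by (simp_all add: comp_def)
  have opt_r: "optimal_threshold (\<gamma> (r k)) (s' (\<gamma> (r k))) (S' (\<gamma> (r k)))" for k
    by (rule opt[OF \<gamma>(1,2)])
  note o = optimal_thresholdD[OF opt_r]
  have pX: "fst p \<in> X" "snd p \<in> X" "fst p \<le> snd p"
    by (rule tendsto_states[OF o(3) sS(1)], rule tendsto_states[OF o(4) sS(2)], rule LIMSEQ_le[OF sS])
       (use o(5) in blast)
  have \<pi>: "sS_policy I (fst p) (snd p) \<in> policies I"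
    unfolding sS_policy_eq by (intro markov_policies sS_decision_rules pX)
  have l_nonneg: "0 \<le> l"
  proof (rule LIMSEQ_le_const[OF l])
    have "0 \<le> (1 - \<gamma> k) * least_value (\<gamma> k)" for k
      using \<gamma>(2)[of k] least_value_nonneg[of "\<gamma> k"] by simp
    then show "\<exists>N. \<forall>n\<ge>N. 0 \<le> (1 - \<gamma> n) * least_value (\<gamma> n)" by blast
  qed
  have "0 \<le> \<gamma>' n" for n using \<gamma>'(1)[of n] \<alpha>\<^sub>0 by simp
  then have "ennreal l' \<le> average_cost I (sS_policy I (fst p) (snd p)) 0"
    by (intro scaled_least_value_le_average_cost[OF \<pi> _ _ \<gamma>'(2,3) l']) auto
  also have "\<dots> \<le> ennreal l"
    using LIMSEQ_subseq_LIMSEQ[OF \<gamma>(3) r(1)] LIMSEQ_subseq_LIMSEQ[OF l r(1)]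
    by (intro threshold_average_cost_le[OF opt_r _ _ sS]) (auto simp: comp_def)
  finally show ?thesis using l_nonneg by (simp add: ennreal_le_iff)
qed

lemma scaled_least_value_bounded:
  assumes \<gamma>: "\<And>n. \<alpha>\<^sub>0 < \<gamma> n" "\<And>n. \<gamma> n < 1"
  shows "bounded (range (\<lambda>n. (1 - \<gamma> n) * least_value (\<gamma> n)))"
proof (rule boundedI)
  fix y assume "y \<in> range (\<lambda>n. (1 - \<gamma> n) * least_value (\<gamma> n))"
  then obtain n where y: "y = (1 - \<gamma> n) * least_value (\<gamma> n)" by blast
  have "y \<ge> 0" unfolding y using \<gamma>(2)[of n] least_value_nonneg[of "\<gamma> n"] by simp
  moreover have "y \<le> K + L 0 + c * mean_demand I"
    unfolding y using \<gamma>[of n] \<alpha>\<^sub>0 by (intro scaled_least_value_le) auto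
  ultimately show "norm y \<le> K + L 0 + c * mean_demand I" by simp
qed

text \<open>The scaled least values are bounded, so every sequence has a convergent subsequence, and
  all subsequential limits agree.\<close>

lemma limit_min_value_exists:
  "\<exists>w\<ge>0. limit_min_value I = ennreal w \<and>
    (\<forall>\<gamma>. (\<forall>n. \<alpha>\<^sub>0 < \<gamma> n) \<and> (\<forall>n. \<gamma> n < 1) \<and> \<gamma> \<longlonglongrightarrow> 1 \<longrightarrow>
       (\<lambda>n. (1 - \<gamma> n) * least_value (\<gamma> n)) \<longlonglongrightarrow> w)"
proof -
  define f where "f \<gamma> = (1 - \<gamma>) * least_value \<gamma>" for \<gamma>
  \<comment> \<open>Any sequence in the interval tending to 1 would do; it only serves to name
    \<open>w\<close>. The double successor keeps the term with index 0 strictly above the left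
    end.\<close>
  define \<gamma>\<^sub>0 where "\<gamma>\<^sub>0 n = 1 - (1 - \<alpha>\<^sub>0) * (1 / real (Suc (Suc n)))" for n
  have \<gamma>\<^sub>0_lt: "\<alpha>\<^sub>0 < \<gamma>\<^sub>0 n" "\<gamma>\<^sub>0 n < 1" for n
  proof -
    have "(1 - \<alpha>\<^sub>0) * (1 / real (Suc (Suc n))) < (1 - \<alpha>\<^sub>0) * 1"
      using \<alpha>\<^sub>0 by (intro mult_strict_left_mono) auto
    then show "\<alpha>\<^sub>0 < \<gamma>\<^sub>0 n" by (simp add: \<gamma>\<^sub>0_def)
    show "\<gamma>\<^sub>0 n < 1" using \<alpha>\<^sub>0 by (simp add: \<gamma>\<^sub>0_def)
  qed
  have \<gamma>\<^sub>0_lim: "\<gamma>\<^sub>0 \<longlonglongrightarrow> 1"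
  proof -
    have "(\<lambda>n. 1 - (1 - \<alpha>\<^sub>0) * (1 / real (Suc (Suc n)))) \<longlonglongrightarrow> 1 - (1 - \<alpha>\<^sub>0) * 0"
      by (intro tendsto_intros LIMSEQ_Suc lim_1_over_n)
    then show ?thesis by (simp add: \<gamma>\<^sub>0_def[abs_def])
  qed
  have subseq: "\<exists>l r. strict_mono r \<and> (\<lambda>n. f (\<gamma> (r n))) \<longlonglongrightarrow> l"
    if "\<And>n. \<alpha>\<^sub>0 < \<gamma> n" "\<And>n. \<gamma> n < 1" for \<gamma> :: "nat \<Rightarrow> real"
    using bounded_imp_convergent_subsequence[OF scaled_least_value_bounded[of \<gamma>, OF that]]
    by (auto simp: f_def comp_def)
  obtain w r where r: "strict_mono r" "(\<lambda>n. f (\<gamma>\<^sub>0 (r n))) \<longlonglongrightarrow> w"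
    using subseq[of \<gamma>\<^sub>0, OF \<gamma>\<^sub>0_lt] by blast
  have \<gamma>\<^sub>0_r: "(\<lambda>n. \<gamma>\<^sub>0 (r n)) \<longlonglongrightarrow> 1"
    using LIMSEQ_subseq_LIMSEQ[OF \<gamma>\<^sub>0_lim r(1)] by (simp add: comp_def)
  have lim: "(\<lambda>n. f (\<gamma> n)) \<longlonglongrightarrow> w"
    if \<gamma>: "\<And>n. \<alpha>\<^sub>0 < \<gamma> n" "\<And>n. \<gamma> n < 1" "\<gamma> \<longlonglongrightarrow> 1" for \<gamma>
  proof (rule ccontr)
    assume "\<not> (\<lambda>n. f (\<gamma> n)) \<longlonglongrightarrow> w"
    then obtain \<epsilon> where \<epsilon>: "\<epsilon> > 0" "\<forall>N. \<exists>n\<ge>N. \<epsilon> \<le> dist (f (\<gamma> n)) w"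
      unfolding lim_sequentially not_all not_ex not_imp not_less by blast
    then have "infinite {n. \<epsilon> \<le> dist (f (\<gamma> n)) w}"
      by (simp add: infinite_nat_iff_unbounded_le)
    then obtain q :: "nat \<Rightarrow> nat" where q: "strict_mono q" "\<And>n. \<epsilon> \<le> dist (f (\<gamma> (q n))) w"
      by (auto dest: infinite_enumerate)
    obtain l q' where q': "strict_mono q'" "(\<lambda>n. f (\<gamma> (q (q' n)))) \<longlonglongrightarrow> l"
      using subseq[of "\<lambda>n. \<gamma> (q n)", OF \<gamma>(1,2)] by blast
    have \<gamma>q: "(\<lambda>n. \<gamma> (q (q' n))) \<longlonglongrightarrow> 1"
      using LIMSEQ_subseq_LIMSEQ[OF LIMSEQ_subseq_LIMSEQ[OF \<gamma>(3) q(1)] q'(1)] by (simp add: comp_def)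
    have "l \<le> w"
      by (rule scaled_least_value_limits_le[OF \<gamma>\<^sub>0_lt \<gamma>\<^sub>0_r \<gamma>(1,2) \<gamma>q r(2)[unfolded f_def] q'(2)[unfolded f_def]])
    moreover have "w \<le> l"
      by (rule scaled_least_value_limits_le[OF \<gamma>(1,2) \<gamma>q \<gamma>\<^sub>0_lt \<gamma>\<^sub>0_r q'(2)[unfolded f_def] r(2)[unfolded f_def]])
    ultimately have "(\<lambda>n. dist (f (\<gamma> (q (q' n)))) w) \<longlonglongrightarrow> dist w w"
      using q'(2) by (intro tendsto_dist tendsto_const) auto
    then have "\<epsilon> \<le> dist w w"
      by (rule LIMSEQ_le_const) (use q(2) in auto)
    then show False using \<epsilon>(1) by simp
  qed
  have "(f \<longlongrightarrow> w) (at_left 1)"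
    using \<alpha>\<^sub>0(2)
  proof (rule tendsto_at_left_sequentially)
    show "(\<lambda>n. f (\<gamma> n)) \<longlonglongrightarrow> w" if "\<And>n. \<gamma> n < 1" "\<And>n. \<alpha>\<^sub>0 < \<gamma> n" "\<gamma> \<longlonglongrightarrow> 1" for \<gamma>
      by (rule lim[OF that(2,1,3)])
  qed
  then have "((\<lambda>\<beta>. ennreal (f \<beta>)) \<longlongrightarrow> ennreal w) (at_left 1)"
    by (rule tendsto_ennrealI)
  moreover have "\<forall>\<^sub>F \<beta> in at_left 1. ennreal (f \<beta>) = ennreal (1 - \<beta>) * min_value I \<beta>"
    using eventually_at_left_real[OF \<alpha>\<^sub>0(2)]
  proof eventually_elim
    case (elim \<beta>)
    then have "0 \<le> \<beta>" "\<beta> < 1" using \<alpha>\<^sub>0 by auto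
    then show ?case
      using least_value_nonneg by (simp add: f_def min_value_finite ennreal_mult)
  qed
  ultimately have "((\<lambda>\<beta>. ennreal (1 - \<beta>) * min_value I \<beta>) \<longlongrightarrow> ennreal w) (at_left 1)"
    by (rule Lim_transform_eventually)
  then have "limit_min_value I = ennreal w"
    unfolding limit_min_value_def by (intro tendsto_Lim) auto
  moreover have "w \<ge> 0"
  proof (rule LIMSEQ_le_const[OF lim[OF \<gamma>\<^sub>0_lt \<gamma>\<^sub>0_lim]])
    have "0 \<le> f (\<gamma>\<^sub>0 n)" for n
      using \<gamma>\<^sub>0_lt(2)[of n] least_value_nonneg[of "\<gamma>\<^sub>0 n"] by (simp add: f_def)
    then show "\<exists>N. \<forall>n\<ge>N. 0 \<le> f (\<gamma>\<^sub>0 n)" by blast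
  qed
  ultimately show ?thesis
    by (intro exI[of _ w] conjI allI impI) (use lim[unfolded f_def] in auto)
qed

end

section \<open>Existence of a minimizing order\<close>

lemma H_function_eq:
  "H_function I u y = ereal (c * y + L y) + enn2ereal (demand_mean u y)"
  by (simp add: H_function_def demand_mean_def)

text \<open>\<open>H\<close> dominates the increasing linear function \<open>c * z\<close> and is
  lower semicontinuous, while the actions form a closed set bounded below. Hence a minimizing
  sequence of orders is bounded and has a limit point that attains the infimum.\<close>

lemma H_function_minimizer:
  fixes \<beta> :: "nat \<Rightarrow> real"
  assumes x: "x \<in> X"
  defines "H \<equiv> H_function I (liminf_relative_value I \<beta>)"
  obtains a where "a \<in> A" "\<And>b. b \<in> A \<Longrightarrow> H (x + a) \<le> H (x + b)"
proof -
  let ?dm = "demand_mean (liminf_relative_value I \<beta>)"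
  define m where "m = (INF b\<in>A. H (x + b))"
  have m_le: "m \<le> H (x + b)" if "b \<in> A" for b unfolding m_def using that by (rule INF_lower)
  have H_ge: "ereal (c * (x + b)) \<le> H (x + b)" if "b \<in> A" for b
  proof -
    have "ereal (c * (x + b)) + 0 \<le> H (x + b)"
      unfolding H_def H_function_eq using L_nonneg[OF state_add[OF x that]] by (intro add_mono) auto
    then show ?thesis by simp
  qed
  have "(\<lambda>b. H (x + b)) ` A \<noteq> {}" using zero_action by (metis empty_iff image_is_empty)
  from Inf_as_limit[OF this]
  obtain h where h: "\<And>n. h n \<in> (\<lambda>b. H (x + b)) ` A" "h \<longlonglongrightarrow> m"
    unfolding m_def by blast
  have "\<forall>n. \<exists>b. b \<in> A \<and> h n = H (x + b)" using h(1) by (auto simp: image_iff)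
  then obtain b where b: "\<And>n. b n \<in> A" "\<And>n. h n = H (x + b n)" by (auto dest!: choice)
  show ?thesis
  proof (cases "m = \<infinity>")
    \<comment> \<open>If the infimum is infinite, \<open>H\<close> is infinite at all reachable
      states and every action is a minimizer.\<close>
    case True
    then show ?thesis by (intro that[OF zero_action]) (use m_le in simp)
  next
    case False
    then obtain \<rho> where \<rho>: "m < ereal \<rho>" using less_PInf_Ex_of_nat[of m] by auto
    obtain N where N: "\<And>n. n \<ge> N \<Longrightarrow> h n < ereal \<rho>"
      using order_tendstoD(2)[OF h(2) \<rho>] by (auto simp: eventually_sequentially)
    have "b (n + N) \<in> {0..(\<rho> - c * x) / c}" for n
    proof -
      have "ereal (c * (x + b (n + N))) < ereal \<rho>"
        by (rule le_less_trans[OF H_ge[OF b(1)]]) (use N[of "n + N"] in \<open>simp add: b(2)\<close>)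
      then show ?thesis using unit_cost_pos action_nonneg[OF b(1)] by (simp add: field_simps)
    qed
    then have "bounded (range (\<lambda>n. b (n + N)))"
      by (intro bounded_subset[OF bounded_closed_interval]) blast
    then obtain a r where r: "strict_mono r" "((\<lambda>n. b (n + N)) \<circ> r) \<longlonglongrightarrow> a"
      using bounded_imp_convergent_subsequence by blast
    define y where "y n = x + b (r n + N)" for n
    have y: "y n \<in> X" for n unfolding y_def by (rule state_add[OF x b(1)])
    have y_lim: "y \<longlonglongrightarrow> x + a"
      unfolding y_def[abs_def] using r(2) by (intro tendsto_add tendsto_const) (simp add: comp_def)
    have a: "a \<in> A" by (rule closed_sequentially[OF closed_actions _ r(2)]) (simp add: b)
    obtain q where q: "strict_mono q" "((\<lambda>n. ?dm (y n)) \<circ> q) \<longlonglongrightarrow> liminf (\<lambda>n. ?dm (y n))"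
      using liminf_subseq_lim by blast
    have yq: "(\<lambda>n. y (q n)) \<longlonglongrightarrow> x + a"
      using LIMSEQ_subseq_LIMSEQ[OF y_lim q(1)] by (simp add: comp_def)
    have "(\<lambda>n. ereal (c * y (q n) + L (y (q n))) + enn2ereal (?dm (y (q n)))) \<longlonglongrightarrow>
       ereal (c * (x + a) + L (x + a)) + enn2ereal (liminf (\<lambda>n. ?dm (y n)))"
    proof (rule tendsto_add_ereal_general)
      show "(\<lambda>n. ereal (c * y (q n) + L (y (q n)))) \<longlonglongrightarrow> ereal (c * (x + a) + L (x + a))"
        by (intro tendsto_intros tendsto_ereal tendsto_L yq y)
      show "(\<lambda>n. enn2ereal (?dm (y (q n)))) \<longlonglongrightarrow> enn2ereal (liminf (\<lambda>n. ?dm (y n)))"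
        using q(2) by (intro tendsto_enn2erealI) (simp add: comp_def)
    qed auto
    moreover have "(\<lambda>n. h (r (q n) + N)) \<longlonglongrightarrow> m"
    proof -
      have "strict_mono (\<lambda>n. r (q n) + N)"
        using r(1) q(1) by (auto simp: strict_mono_def)
      from LIMSEQ_subseq_LIMSEQ[OF h(2) this] show ?thesis by (simp add: comp_def)
    qed
    moreover have "h (r (q n) + N) = ereal (c * y (q n) + L (y (q n))) + enn2ereal (?dm (y (q n)))" for n
      unfolding b(2) y_def H_def H_function_eq ..
    ultimately have m: "m = ereal (c * (x + a) + L (x + a)) + enn2ereal (liminf (\<lambda>n. ?dm (y n)))"
      using LIMSEQ_unique by simp
    have "H (x + a) \<le> m"
      unfolding m H_def H_function_eq
      using demand_mean_lsc[OF y_lim] by (intro add_left_mono) (simp add: less_eq_ennreal.rep_eq)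
    then show ?thesis using that[OF a] m_le by (meson order_trans)
  qed
qed

end

theorem theorem4p3:
  fixes I :: "'a inventory"
    and \<alpha>\<^sub>0 :: real
    and s' S' :: "real \<Rightarrow> real"
    and \<alpha> :: "nat \<Rightarrow> real"
  assumes model: "inventory_model I"
    and threshold: "0 \<le> \<alpha>\<^sub>0" "\<alpha>\<^sub>0 < 1"
    and quasiconvex: "\<And>\<beta>. \<alpha>\<^sub>0 < \<beta> \<Longrightarrow> \<beta> \<le> 1 \<Longrightarrow>
          quasiconvex_on (states I) (mean_after_demand I (discounted_holding I \<beta>))"
    and left_limit: "\<And>\<beta>. \<alpha>\<^sub>0 < \<beta> \<Longrightarrow> \<beta> \<le> 1 \<Longrightarrow>
          \<exists>L::ereal.
            ((\<lambda>x. ereal (mean_after_demand I (discounted_holding I \<beta>) x)) \<longlongrightarrow> L)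
              (inf at_bot (principal (states I))) \<and>
            L > ereal (order_cost I) +
                (INF x\<in>states I. ereal (mean_after_demand I (discounted_holding I \<beta>) x))"
    and optimal_sS: "\<And>\<beta>. \<alpha>\<^sub>0 < \<beta> \<Longrightarrow> \<beta> < 1 \<Longrightarrow>
          s' \<beta> \<in> states I \<and> S' \<beta> \<in> states I \<and> s' \<beta> \<le> S' \<beta> \<and>
          discounted_optimal I \<beta> (sS_policy I (s' \<beta>) (S' \<beta>))"
    and discounts: "incseq \<alpha>" "\<And>n. \<alpha> n < 1" "\<alpha> \<longlonglongrightarrow> 1" "\<alpha>\<^sub>0 < \<alpha> 0"
  shows "bounded (range (\<lambda>n. (s' (\<alpha> n), S' (\<alpha> n)))) \<and>
    (\<forall>s S r. strict_mono r \<and> (\<lambda>k. (s' (\<alpha> (r k)), S' (\<alpha> (r k)))) \<longlonglongrightarrow> (s, S) \<longrightarrow>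
      average_optimal I (sS_policy I s S) \<and>
      (let u = liminf_relative_value I (\<alpha> \<circ> r);
           H = H_function I u;
           w = enn2ereal (limit_min_value I);
           c = unit_cost I;
           K = order_cost I
       in \<forall>x\<in>states I.
         w + enn2ereal (u x) \<ge>
           ereal (if sS_action s S x > 0 then K else 0) + H (x + sS_action s S x) - ereal (c * x) \<and>
         (\<exists>a\<in>actions I. (\<forall>b\<in>actions I. ereal K + H (x + a) \<le> ereal K + H (x + b)) \<and>
           w + enn2ereal (u x) \<ge> min (ereal K + H (x + a)) (H x) - ereal (c * x))))"
proof -
  interpret inventory_model I by (rule model)
  \<comment> \<open>The midpoint is a factor below 1 at which the limit condition is available, as
    \<open>thresholds_bounded\<close> demands.\<close>
  define \<beta>\<^sub>1 where "\<beta>\<^sub>1 = (\<alpha>\<^sub>0 + 1) / 2"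
  have \<beta>\<^sub>1: "\<alpha>\<^sub>0 < \<beta>\<^sub>1" "\<beta>\<^sub>1 < 1" using threshold by (auto simp: \<beta>\<^sub>1_def)
  have opt: "optimal_threshold \<beta> (s' \<beta>) (S' \<beta>)" if "\<alpha>\<^sub>0 < \<beta>" "\<beta> < 1" for \<beta>
    using optimal_sS[OF that] that threshold by (simp add: optimal_threshold_def)
  obtain l where l: "((\<lambda>x. ereal (mean_after_demand I (discounted_holding I \<beta>\<^sub>1) x)) \<longlongrightarrow> l)
      (inf at_bot (principal X))"
    and l_gt: "ereal K + (INF x\<in>X. ereal (mean_after_demand I (discounted_holding I \<beta>\<^sub>1) x)) < l"
    using left_limit[of \<beta>\<^sub>1] \<beta>\<^sub>1 by auto
  have "-\<infinity> < l" by (rule le_less_trans[OF _ l_gt]) simp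
  note l = l this
  have \<alpha>: "\<alpha>\<^sub>0 < \<alpha> n" for n
    using discounts(4) incseqD[OF discounts(1), of 0 n] by simp
  obtain w where w: "w \<ge> 0" "limit_min_value I = ennreal w"
    "\<forall>\<gamma>. (\<forall>n. \<alpha>\<^sub>0 < \<gamma> n) \<and> (\<forall>n. \<gamma> n < 1) \<and> \<gamma> \<longlonglongrightarrow> 1 \<longrightarrow>
       (\<lambda>n. (1 - \<gamma> n) * least_value (\<gamma> n)) \<longlonglongrightarrow> w"
  proof -
    have "\<exists>w\<ge>0. limit_min_value I = ennreal w \<and>
      (\<forall>\<gamma>. (\<forall>n. \<alpha>\<^sub>0 < \<gamma> n) \<and> (\<forall>n. \<gamma> n < 1) \<and> \<gamma> \<longlonglongrightarrow> 1 \<longrightarrow>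
       (\<lambda>n. (1 - \<gamma> n) * least_value (\<gamma> n)) \<longlonglongrightarrow> w)"
      by (rule limit_min_value_exists[OF threshold _ \<beta>\<^sub>1(2) l]) (rule opt)
    then show ?thesis by (elim exE conjE) (rule that)
  qed
  have bnd: "bounded (range (\<lambda>n. (s' (\<alpha> n), S' (\<alpha> n))))"
    by (rule threshold_sequence_bounded[OF threshold _ \<beta>\<^sub>1(2) l \<alpha> discounts(2,3)]) (rule opt)
  have key: "average_optimal I (sS_policy I s S) \<and>
      (\<forall>x\<in>X.
         ereal (if sS_action s S x > 0 then K else 0) + H_function I (liminf_relative_value I (\<alpha> \<circ> r)) (x + sS_action s S x) - ereal (c * x)
           \<le> enn2ereal (limit_min_value I) + enn2ereal (liminf_relative_value I (\<alpha> \<circ> r) x) \<and>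
         (\<exists>a\<in>A. (\<forall>b\<in>A. ereal K + H_function I (liminf_relative_value I (\<alpha> \<circ> r)) (x + a) \<le> ereal K + H_function I (liminf_relative_value I (\<alpha> \<circ> r)) (x + b)) \<and>
           min (ereal K + H_function I (liminf_relative_value I (\<alpha> \<circ> r)) (x + a)) (H_function I (liminf_relative_value I (\<alpha> \<circ> r)) x) - ereal (c * x)
           \<le> enn2ereal (limit_min_value I) + enn2ereal (liminf_relative_value I (\<alpha> \<circ> r) x)))"
    if r: "strict_mono r" and lim: "(\<lambda>k. (s' (\<alpha> (r k)), S' (\<alpha> (r k)))) \<longlonglongrightarrow> (s, S)" for s S r
  proof -
    define u where "u = liminf_relative_value I (\<alpha> \<circ> r)"
    define H where "H = H_function I u"
    let ?\<phi> = "sS_action s S"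
    have sS: "(\<lambda>k. s' ((\<alpha> \<circ> r) k)) \<longlonglongrightarrow> s" "(\<lambda>k. S' ((\<alpha> \<circ> r) k)) \<longlonglongrightarrow> S"
      using tendsto_fst[OF lim] tendsto_snd[OF lim] by simp_all
    have opt_r: "optimal_threshold ((\<alpha> \<circ> r) k) (s' ((\<alpha> \<circ> r) k)) (S' ((\<alpha> \<circ> r) k))" for k
      using opt[OF \<alpha> discounts(2)] by simp
    note o = optimal_thresholdD[OF opt_r]
    have \<alpha>r: "(\<alpha> \<circ> r) \<longlonglongrightarrow> 1" by (rule LIMSEQ_subseq_LIMSEQ[OF discounts(3) r])
    have wr: "(\<lambda>k. (1 - (\<alpha> \<circ> r) k) * least_value ((\<alpha> \<circ> r) k)) \<longlonglongrightarrow> w"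
        by (rule w(3)[rule_format]) (use \<alpha> discounts(2) \<alpha>r in \<open>simp add: comp_def\<close>)
    have X: "s \<in> X" "S \<in> X" "s \<le> S"
      by (rule tendsto_states[OF o(3) sS(1)], rule tendsto_states[OF o(4) sS(2)], rule LIMSEQ_le[OF sS])
       (use o(5) in blast)
    have f: "(\<lambda>_. ?\<phi>) \<in> decision_rules" by (rule sS_decision_rules[OF X])
    have \<pi>: "sS_policy I s S \<in> policies I"
      unfolding sS_policy_eq by (rule markov_policies[OF f])
    have "average_cost I (sS_policy I s S) x = (INF \<pi>'\<in>policies I. average_cost I \<pi>' x)" if x: "x \<in> X" for x
    proof (rule antisym)
      have "average_cost I (sS_policy I s S) x \<le> ennreal w"
        by (rule threshold_average_cost_le[OF opt_r \<alpha>r wr sS x])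
      also have "\<dots> \<le> (INF \<pi>'\<in>policies I. average_cost I \<pi>' x)"
        by (intro INF_greatest scaled_least_value_le_average_cost[OF _ x o(1,2) \<alpha>r wr])
      finally show "average_cost I (sS_policy I s S) x \<le> (INF \<pi>'\<in>policies I. average_cost I \<pi>' x)" .
      show "(INF \<pi>'\<in>policies I. average_cost I \<pi>' x) \<le> average_cost I (sS_policy I s S) x"
        by (rule INF_lower[OF \<pi>])
    qed
    then have avg: "average_optimal I (sS_policy I s S)"
      using \<pi> by (simp add: average_optimal_def)
    have ineq: "ereal (if ?\<phi> x > 0 then K else 0) + H (x + ?\<phi> x) - ereal (c * x)
           \<le> enn2ereal (limit_min_value I) + enn2ereal (u x) \<and>
         (\<exists>a\<in>A. (\<forall>b\<in>A. ereal K + H (x + a) \<le> ereal K + H (x + b)) \<and>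
           min (ereal K + H (x + a)) (H x) - ereal (c * x)
           \<le> enn2ereal (limit_min_value I) + enn2ereal (u x))" if x: "x \<in> X" for x
    proof -
      have \<phi>: "?\<phi> x \<in> A" using decision_rule_action[OF f x] .
      let ?e = "enn2ereal (demand_mean u (x + ?\<phi> x))"
      have "ennreal (stage_cost I x (?\<phi> x)) + demand_mean u (x + ?\<phi> x) \<le> ennreal w + u x"
        unfolding u_def by (rule optimality_inequality[OF opt_r \<alpha>r wr sS x])
      then have "ereal (stage_cost I x (?\<phi> x)) + ?e \<le> ereal w + enn2ereal (u x)"
        using w(1) stage_cost_nonneg[OF x \<phi>]
        by (simp add: less_eq_ennreal.rep_eq plus_ennreal.rep_eq enn2ereal_ennreal)
      moreover have "ereal (if ?\<phi> x > 0 then K else 0) + H (x + ?\<phi> x) - ereal (c * x) = ereal (stage_cost I x (?\<phi> x)) + ?e"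
      proof -
        \<comment> \<open>\<open>e\<close> may be infinite, so only the finite terms are rearranged.
          The unit cost of the order is the difference of \<open>c * (x + a)\<close> and
          \<open>c * x\<close>.\<close>
        have "ereal k + (ereal p + e) - ereal q = ereal (k + p - q) + e" for k p q e
          by (cases e) auto
        then show ?thesis
          unfolding H_def H_function_eq stage_cost_def by (simp add: algebra_simps)
      qed
      ultimately have 1: "ereal (if ?\<phi> x > 0 then K else 0) + H (x + ?\<phi> x) - ereal (c * x)
           \<le> enn2ereal (limit_min_value I) + enn2ereal (u x)"
        using w(1,2) by (simp add: enn2ereal_ennreal)
      obtain a where a: "a \<in> A" "\<And>b. b \<in> A \<Longrightarrow> H (x + a) \<le> H (x + b)"
        unfolding H_def u_def by (rule H_function_minimizer[OF x]) blast
      \<comment> \<open>The threshold action is either a positive order, bounded below by the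
        minimizing one, or no order, the other entry of the minimum.\<close>
      have "min (ereal K + H (x + a)) (H x) \<le> ereal (if ?\<phi> x > 0 then K else 0) + H (x + ?\<phi> x)"
      proof (cases "?\<phi> x > 0")
        case True
        then show ?thesis using a(2)[OF \<phi>] by (simp add: min.coboundedI1 add_left_mono)
      next
        case False
        then have "?\<phi> x = 0" using action_nonneg[OF \<phi>] by simp
        then show ?thesis by (simp add: zero_ereal_def[symmetric])
      qed
      then have "min (ereal K + H (x + a)) (H x) - ereal (c * x) \<le> enn2ereal (limit_min_value I) + enn2ereal (u x)"
        using 1 by (meson ereal_minus_mono order_refl order_trans)
      then show ?thesis using 1 a(1) by (intro conjI bexI[of _ a] ballI add_left_mono a(2))
    qed
    show ?thesis
      by (rule conjI[OF avg ballI], rule ineq[unfolded H_def u_def])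
  qed
  show ?thesis
    unfolding Let_def by (intro conjI[OF bnd] allI impI, elim conjE) (rule key; assumption)
qed

end
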